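(* For integers $n\ge 0$ and complex $k$ put \[ U(n,k)=\frac{(1)_n\, (1+k)_n\, (1+2k)_n\left( 1+\frac{k}{2}\right)_n\left(\frac12+\frac{k}{2}\right)_n} {\left( \frac12 \right)_n \left( \frac12+k \right)_n \left(1+ \frac{2k}{3} \right)_n \left( \frac13+\frac{2k}{3} \right)_n \left( \frac23+\frac{2k}{3} \right)_n}\, \frac{(1)_k^2}{\left( \frac12\right)_k^2}, \] \[ R(n,k)=\frac{22n^3 + (34k + 49)n^2 + (12k^2 + 48k + 35)n + 8(k + 1)^2}{2(1 + 2n)(3 + 2k + 3n)(2n + 2k + 1)(3n + 2k + 1)(3n + 2k + 2)}, \] and $G(n,k)=U(n,k)\,R(n,k)\left(\frac{16}{27}\right)^n$. Then \[ \sum_{n=0}^{\infty} G(n,k) = \frac{\pi^2}{8} \] for all $k\in\mathbb{C}$ for which all terms of the series are defined, i.e. for all $k\in\mathbb C$ such that $2k$ is not a negative integer (the exceptional $k$ being removable singularities of the sum).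
   Context: For complex $a$ and integer $n\ge 0$, $(a)_n$ denotes the rising factorial: $(a)_0=1$, $(a)_n=a(a+1)\cdots(a+n-1)$. For complex $k$, $(a)_k=\Gamma(a+k)/\Gamma(a)$. *)

theory Defs
  imports "HOL-Complex_Analysis.Complex_Analysis"
begin

text \<open>
  The rising factorial \<open>(a)\<^sub>n\<close> with integer \<open>n \<ge> 0\<close> is \<^const>\<open>pochhammer\<close>; the following is
  \<open>(a)\<^sub>k\<close> for complex \<open>k\<close>.
\<close>

definition cpochhammer :: "complex \<Rightarrow> complex \<Rightarrow> complex" where
  "cpochhammer a k = Gamma (a + k) / Gamma a"

definition U_num :: "nat \<Rightarrow> complex \<Rightarrow> complex" where
  "U_num n k =
     pochhammer 1 n * pochhammer (1 + k) n * pochhammer (1 + 2 * k) n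
       * pochhammer (1 + k / 2) n * pochhammer (1 / 2 + k / 2) n"

definition U_den :: "nat \<Rightarrow> complex \<Rightarrow> complex" where
  "U_den n k =
     pochhammer (1 / 2) n * pochhammer (1 / 2 + k) n * pochhammer (1 + 2 * k / 3) n
       * pochhammer (1 / 3 + 2 * k / 3) n * pochhammer (2 / 3 + 2 * k / 3) n"

definition U :: "nat \<Rightarrow> complex \<Rightarrow> complex" where
  "U n k = U_num n k / U_den n k * ((cpochhammer 1 k)\<^sup>2 / (cpochhammer (1 / 2) k)\<^sup>2)"

definition R_num :: "nat \<Rightarrow> complex \<Rightarrow> complex" where
  "R_num n k =
     22 * of_nat n ^ 3 + (34 * k + 49) * of_nat n ^ 2
       + (12 * k ^ 2 + 48 * k + 35) * of_nat n + 8 * (k + 1) ^ 2"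

definition R_den :: "nat \<Rightarrow> complex \<Rightarrow> complex" where
  "R_den n k =
     2 * (1 + 2 * of_nat n) * (3 + 2 * k + 3 * of_nat n) * (2 * of_nat n + 2 * k + 1)
       * (3 * of_nat n + 2 * k + 1) * (3 * of_nat n + 2 * k + 2)"

definition R :: "nat \<Rightarrow> complex \<Rightarrow> complex" where
  "R n k = R_num n k / R_den n k"

definition G :: "nat \<Rightarrow> complex \<Rightarrow> complex" where
  "G n k = U n k * R n k * (16 / 27) ^ n"

text \<open>
  In HOL division and \<^const>\<open>Gamma\<close> are total (with value 0 at the singular arguments), so that
  an expression is defined has to be said explicitly: no Gamma function is evaluated at a pole
  and no denominator vanishes.
\<close>

definition G_defined :: "nat \<Rightarrow> complex \<Rightarrow> bool" where
  "G_defined n k \<longleftrightarrow>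
     1 + k \<notin> \<int>\<^sub>\<le>\<^sub>0 \<and> 1 / 2 + k \<notin> \<int>\<^sub>\<le>\<^sub>0 \<and> cpochhammer (1 / 2) k \<noteq> 0 \<and>
     U_den n k \<noteq> 0 \<and> R_den n k \<noteq> 0"

definition removable_singularity_at :: "(complex \<Rightarrow> complex) \<Rightarrow> complex \<Rightarrow> bool" where
  "removable_singularity_at f z \<longleftrightarrow>
     isolated_singularity_at f z \<and> (\<exists>L. (f \<longlongrightarrow> L) (at z))"

end

theory Submission
  imports Defs
begin

text \<open>
  Write \<open>W n k = U n k (16/27)\<^sup>n\<close> for the hypergeometric part of \<open>G n k = W n k R n k\<close> and
  \<open>S k = (\<Sum>n. G n k)\<close>. The value of \<open>S\<close> follows from four facts.

  \<^item> \<open>S\<close> has period 1. There is a Wilf-Zeilberger partner \<open>F n k = W n k C n k\<close> with a rational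
    function \<open>C\<close> such that \<open>G n (k + 1) - G n k = F (n + 1) k - F n k\<close> (\<open>wz_equation\<close>). As
    \<open>F 0 k = 0\<close> and \<open>F n k \<longlonglongrightarrow> 0\<close>, summing over \<open>n\<close> gives \<open>S (k + 1) = S k\<close>
    (\<open>G_sums_plus_1_iff\<close>).

  \<^item> \<open>S\<close> is holomorphic on the strip \<open>0 < Re k < 2\<close> and grows there at most like
    \<open>exp (3 \<bar>Im k\<bar>)\<close>. For \<open>n \<ge> 1\<close> and up to a factor \<open>((n + 1) / n)\<^sup>3\<close>, which
    only contributes \<open>n\<^sup>3\<close> to the product, the quotient \<open>\<bar>W (n + 1) k / W n k\<bar>\<close> is at most
    \<open>16/9\<close> always and at most \<open>8/9\<close> from about \<open>n = 2 \<bar>Im k\<bar>\<close> on. So the terms decay geometrically, after an initial segment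
    that costs a factor \<open>2\<close> for each of its about \<open>2 \<bar>Im k\<bar>\<close> steps (\<open>norm_G_le\<close>,
    \<open>norm_G_le_strip\<close>).

  \<^item> A holomorphic function of period 1 whose growth is at most \<open>exp (c \<bar>Im k\<bar>)\<close> with
    \<open>c < 2\<pi>\<close> is constant (\<open>periodic_small_growth_imp_constant\<close>): read as a function of \<open>exp (2\<pi>\<i>k)\<close> on the punctured
    plane, it grows too slowly to have a singularity at 0 or at infinity. Since \<open>3 < 2\<pi>\<close>,
    \<open>S\<close> is constant.

  \<^item> The constant is found at \<open>k = -1/2\<close>. There the double zero of \<open>(1)\<^sub>k\<^sup>2 / (1/2)\<^sub>k\<^sup>2\<close> is
    cancelled by the denominator of \<open>R 0 k\<close>, whereas the terms with \<open>n \<ge> 1\<close> keep a simple zero,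
    uniformly enough for the whole tail to vanish. Hence \<open>S\<close> equals the limit of \<open>G 0 k\<close>, which
    is \<open>\<pi>\<^sup>2/8\<close> (\<open>suminf_G_1\<close>).

  Near an exceptional \<open>k\<close> the sum is therefore the constant \<open>\<pi>\<^sup>2/8\<close> on a punctured disc, so that
  the singularity is removable.
\<close>

section \<open>Parameters for which all terms are defined\<close>

definition admissible :: "complex \<Rightarrow> bool" where
  "admissible k \<longleftrightarrow> \<not> (\<exists>m::int. m < 0 \<and> 2 * k = of_int m)"

lemma admissible_nonzero:
  assumes "admissible k" "m > 0"
  shows "2 * k + of_nat m \<noteq> 0"
proof
  assume "2 * k + of_nat m = 0"
  then have "2 * k = of_int (- int m)"
    by (simp add: add_eq_0_iff2)
  with assms show False
    unfolding admissible_def by (metis neg_less_0_iff_less of_nat_0_less_iff)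
qed

lemma admissible_iff: "admissible k \<longleftrightarrow> (\<forall>m>0. 2 * k + of_nat m \<noteq> 0)"
proof
  assume *: "\<forall>m>0. 2 * k + of_nat m \<noteq> 0"
  show "admissible k"
    unfolding admissible_def
  proof safe
    fix m :: int
    assume m: "m < 0" "2 * k = of_int m"
    then have "2 * k + of_nat (nat (- m)) = 0" by simp
    with * m(1) show False by (metis neg_0_less_iff_less zero_less_nat_eq)
  qed
qed (use admissible_nonzero in blast)

lemma admissible_plus_1: "admissible k \<Longrightarrow> admissible (k + 1)"
proof -
  assume "admissible k"
  then have "2 * k + of_nat (m + 2) \<noteq> 0" if "m > 0" for m
    by (intro admissible_nonzero) auto
  then show ?thesis unfolding admissible_iff by (simp add: algebra_simps)
qed

lemma linear_nonzero:
  assumes "admissible k"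
  shows "2 * k + 1 \<noteq> 0" "2 * of_nat n + 2 * k + 1 \<noteq> 0" "3 * of_nat n + 2 * k + 1 \<noteq> 0"
    "3 * of_nat n + 2 * k + 2 \<noteq> 0" "3 * of_nat n + 2 * k + 3 \<noteq> 0"
    "2 * of_nat n + (1::complex) \<noteq> 0" "1 + k \<noteq> 0"
    "2 * of_nat n + 2 * k + 3 \<noteq> 0" "3 * of_nat n + 2 * k + 4 \<noteq> 0"
    "3 * of_nat n + 2 * k + 5 \<noteq> 0"
proof -
  show "2 * k + 1 \<noteq> 0" using admissible_nonzero[OF assms, of 1] by simp
  show "2 * of_nat n + 2 * k + 1 \<noteq> 0" using admissible_nonzero[OF assms, of "2 * n + 1"] by (simp add: algebra_simps)
  show "2 * of_nat n + 2 * k + 3 \<noteq> 0" using admissible_nonzero[OF assms, of "2 * n + 3"] by (simp add: algebra_simps)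
  show "3 * of_nat n + 2 * k + 1 \<noteq> 0" using admissible_nonzero[OF assms, of "3 * n + 1"] by (simp add: algebra_simps)
  show "3 * of_nat n + 2 * k + 2 \<noteq> 0" using admissible_nonzero[OF assms, of "3 * n + 2"] by (simp add: algebra_simps)
  show "3 * of_nat n + 2 * k + 3 \<noteq> 0" using admissible_nonzero[OF assms, of "3 * n + 3"] by (simp add: algebra_simps)
  show "3 * of_nat n + 2 * k + 4 \<noteq> 0" using admissible_nonzero[OF assms, of "3 * n + 4"] by (simp add: algebra_simps)
  show "3 * of_nat n + 2 * k + 5 \<noteq> 0" using admissible_nonzero[OF assms, of "3 * n + 5"] by (simp add: algebra_simps)
  have "2 * k + 2 \<noteq> 0" using admissible_nonzero[OF assms, of 2] by simp
  then show "1 + k \<noteq> 0" by (auto simp: add_eq_0_iff)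
  have "of_nat (2 * n + 1) \<noteq> (0 :: complex)" unfolding of_nat_eq_0_iff by simp
  then show "2 * of_nat n + (1::complex) \<noteq> 0" by (simp add: add_ac)
qed

text \<open>Each of these numbers becomes \<open>2 k\<close> plus a positive integer after multiplication by 2 or 3.\<close>

lemma admissible_notin_nonpos_Ints:
  assumes "admissible k"
  shows "1 + k \<notin> \<int>\<^sub>\<le>\<^sub>0" "1 / 2 + k \<notin> \<int>\<^sub>\<le>\<^sub>0"
    "1 + 2 * k / 3 \<notin> \<int>\<^sub>\<le>\<^sub>0" "1 / 3 + 2 * k / 3 \<notin> \<int>\<^sub>\<le>\<^sub>0" "2 / 3 + 2 * k / 3 \<notin> \<int>\<^sub>\<le>\<^sub>0"
proof -
  have *: "z \<notin> \<int>\<^sub>\<le>\<^sub>0" if z: "of_nat q * z = 2 * k + of_nat (Suc r)" for z :: complex and q r :: nat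
  proof
    assume "z \<in> \<int>\<^sub>\<le>\<^sub>0"
    then obtain j where "z = - of_nat j" by (auto elim: nonpos_Ints_cases')
    then have "2 * k + of_nat (Suc r) = - of_nat (q * j)" using z by simp
    then have "2 * k + of_nat (Suc r + q * j) = 0"
      unfolding of_nat_add add.assoc[symmetric] by simp
    then show False using admissible_nonzero[OF assms, of "Suc r + q * j"] by simp
  qed
  show "1 + k \<notin> \<int>\<^sub>\<le>\<^sub>0" by (rule *[of 2 _ 1]) (simp add: algebra_simps)
  show "1 / 2 + k \<notin> \<int>\<^sub>\<le>\<^sub>0" by (rule *[of 2 _ 0]) (simp add: algebra_simps)
  show "1 + 2 * k / 3 \<notin> \<int>\<^sub>\<le>\<^sub>0" by (rule *[of 3 _ 2]) (simp add: algebra_simps)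
  show "1 / 3 + 2 * k / 3 \<notin> \<int>\<^sub>\<le>\<^sub>0" by (rule *[of 3 _ 0]) (simp add: algebra_simps)
  show "2 / 3 + 2 * k / 3 \<notin> \<int>\<^sub>\<le>\<^sub>0" by (rule *[of 3 _ 1]) (simp add: algebra_simps)
qed

lemma pochhammer_nonzero: "a \<notin> \<int>\<^sub>\<le>\<^sub>0 \<Longrightarrow> pochhammer a n \<noteq> 0" for a :: complex
  by (auto simp: pochhammer_eq_0_iff)

lemma admissible_iff_G_defined: "(\<forall>n. G_defined n k) \<longleftrightarrow> admissible k"
proof
  assume "\<forall>n. G_defined n k"
  then have *: "1 + k \<notin> \<int>\<^sub>\<le>\<^sub>0" "1 / 2 + k \<notin> \<int>\<^sub>\<le>\<^sub>0"
    by (auto simp: G_defined_def)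
  show "admissible k"
    unfolding admissible_iff
  proof (intro allI impI notI)
    fix m :: nat
    assume "m > 0" and m: "2 * k + of_nat m = 0"
    show False
    proof (cases "even m")
      case True
      then obtain j where "m = 2 * Suc j" using \<open>m > 0\<close> by (metis dvdE gr0_implies_Suc nat_0_less_mult_iff)
      then have "2 * (1 + k + of_nat j) = 2 * k + of_nat m" by (simp add: algebra_simps)
      then have "1 + k + of_nat j = 0" using m by (metis mult_eq_0_iff zero_neq_numeral)
      then have "1 + k = - of_nat j" by (simp only: eq_neg_iff_add_eq_0)
      then show False using *(1) by simp
    next
      case False
      then obtain j where "m = 2 * j + 1" by (elim oddE)
      then have "2 * (1 / 2 + k + of_nat j) = 2 * k + of_nat m" by (simp add: algebra_simps)
      then have "1 / 2 + k + of_nat j = 0" using m by (metis mult_eq_0_iff zero_neq_numeral)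
      then have "1 / 2 + k = - of_nat j" by (simp only: eq_neg_iff_add_eq_0)
      then show False using *(2) by simp
    qed
  qed
next
  assume adm: "admissible k"
  note np = admissible_notin_nonpos_Ints[OF adm]
  have "(1 / 2 :: complex) \<notin> \<int>\<^sub>\<le>\<^sub>0"
    using admissible_notin_nonpos_Ints(2)[of 0] by (simp add: admissible_def)
  then have "U_den n k \<noteq> 0" "cpochhammer (1 / 2) k \<noteq> 0" for n
    using np by (simp_all add: U_den_def cpochhammer_def pochhammer_nonzero Gamma_eq_zero_iff)
  moreover have "R_den n k \<noteq> 0" for n
  proof -
    have "R_den n k = 2 * (2 * of_nat n + 1) * (3 * of_nat n + 2 * k + 3) * (2 * of_nat n + 2 * k + 1)
       * (3 * of_nat n + 2 * k + 1) * (3 * of_nat n + 2 * k + 2)"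
      by (simp add: R_den_def add_ac)
    then show ?thesis using linear_nonzero[OF adm] by (simp only: mult_eq_0_iff) simp
  qed
  ultimately have "G_defined n k" for n
    unfolding G_defined_def using np by blast
  then show "\<forall>n. G_defined n k" by blast
qed

lemma admissible_plus_nat:
  assumes "admissible k"
  shows "admissible (k + of_nat j)"
proof (induction j)
  case (Suc j)
  have "k + of_nat (Suc j) = (k + of_nat j) + 1" by simp
  then show ?case using admissible_plus_1[OF Suc] by (simp only:)
qed (use assms in simp)

lemma Re_gt_imp_admissible:
  assumes "Re k > - (1 / 2)"
  shows "admissible k"
  unfolding admissible_iff
proof (intro allI impI notI)
  fix m :: nat
  assume m: "m > 0" "2 * k + of_nat m = 0"
  then have "Re (2 * k + of_nat m) = 0" by simp
  then show False using assms m(1) by simp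
qed

section \<open>The Wilf-Zeilberger pair\<close>

definition weight :: "nat \<Rightarrow> complex \<Rightarrow> complex" where
  "weight n k = U n k * (16 / 27) ^ n"

definition weight_ratio :: "nat \<Rightarrow> complex \<Rightarrow> complex" where
  "weight_ratio n k = 16 * ((of_nat n + 1) * (of_nat n + 1 + k) * (of_nat n + 1 + 2 * k)
      * (2 * of_nat n + 2 + k) * (2 * of_nat n + 1 + k))
    / ((2 * of_nat n + 1) * (2 * of_nat n + 2 * k + 1) * (3 * of_nat n + 2 * k + 1)
      * (3 * of_nat n + 2 * k + 2) * (3 * of_nat n + 2 * k + 3))"

text \<open>
  The rational certificate: \<open>weight n k * certificate n k\<close> is the partner of \<open>G\<close>. Its denominator is
  dictated by those of \<open>R\<close> and of the two quotients of \<open>weight\<close>; the remaining numerator, linear in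
  \<open>n\<close> apart from the factor \<open>n\<close> that makes the partner vanish at 0, is the solution of the linear
  system that \<open>wz_equation\<close> imposes on its coefficients.
\<close>

definition certificate :: "nat \<Rightarrow> complex \<Rightarrow> complex" where
  "certificate n k = - (of_nat n * (4 * of_nat n + 4 * k + 3))
    / (2 * (2 * k + 1) * (2 * of_nat n + 2 * k + 1) * (3 * of_nat n + 2 * k + 1)
      * (3 * of_nat n + 2 * k + 2))"

lemma weight_Suc: "weight (Suc n) k = weight_ratio n k * weight n k"
proof -
  let ?x = "of_nat n :: complex"
  have num: "U_num (Suc n) k = U_num n k * ((1 + ?x) * (1 + k + ?x) * (1 + 2 * k + ?x)
      * (1 + k / 2 + ?x) * (1 / 2 + k / 2 + ?x))"
    unfolding U_num_def pochhammer_Suc by (simp only: mult_ac)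
  have den: "U_den (Suc n) k = U_den n k * ((1 / 2 + ?x) * (1 / 2 + k + ?x) * (1 + 2 * k / 3 + ?x)
      * (1 / 3 + 2 * k / 3 + ?x) * (2 / 3 + 2 * k / 3 + ?x))"
    unfolding U_den_def pochhammer_Suc by (simp only: mult_ac)
  have num': "(1 + ?x) * (1 + k + ?x) * (1 + 2 * k + ?x) * (1 + k / 2 + ?x) * (1 / 2 + k / 2 + ?x)
     = ((?x + 1) * (?x + 1 + k) * (?x + 1 + 2 * k) * (2 * ?x + 2 + k) * (2 * ?x + 1 + k)) / 4"
    by (simp add: field_simps)
  have den': "(1 / 2 + ?x) * (1 / 2 + k + ?x) * (1 + 2 * k / 3 + ?x)
      * (1 / 3 + 2 * k / 3 + ?x) * (2 / 3 + 2 * k / 3 + ?x)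
     = ((2 * ?x + 1) * (2 * ?x + 2 * k + 1) * (3 * ?x + 2 * k + 1)
      * (3 * ?x + 2 * k + 2) * (3 * ?x + 2 * k + 3)) / 108"
    by (simp add: field_simps)
  show ?thesis
    unfolding weight_def U_def num den num' den' weight_ratio_def
    by (simp add: mult_ac)
qed

definition shift_ratio :: "nat \<Rightarrow> complex \<Rightarrow> complex" where
  "shift_ratio n k = 4 * ((1 + k + of_nat n) * (1 + 2 * k + of_nat n) * (2 + 2 * k + of_nat n)
      * (1 + k + 2 * of_nat n))
    / ((2 * k + 1) * (2 * of_nat n + 2 * k + 1) * (3 * of_nat n + 2 * k + 1)
      * (3 * of_nat n + 2 * k + 2))"

text \<open>
  \<open>(1)\<^sub>k / (1/2)\<^sub>k\<close> up to the factor \<open>Gamma (1/2)\<close>. The reciprocal Gamma function is entire, which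
  makes holomorphy and the zero at \<open>k = -1/2\<close> visible.
\<close>

definition gamma_quot :: "complex \<Rightarrow> complex" where
  "gamma_quot k = Gamma (1 + k) * rGamma (1 / 2 + k)"

lemma cpochhammer_quot:
  "(cpochhammer 1 k)\<^sup>2 / (cpochhammer (1 / 2) k)\<^sup>2 = of_real pi * (gamma_quot k)\<^sup>2"
proof -
  have "(Gamma (1/2 :: complex))\<^sup>2 = of_real pi"
    by (simp add: Gamma_one_half_complex flip: of_real_power)
  then show ?thesis
    by (simp add: cpochhammer_def gamma_quot_def rGamma_inverse_Gamma divide_simps power2_eq_square)
qed

lemma gamma_quot_plus_1:
  assumes "admissible k"
  shows "gamma_quot (k + 1) = (1 + k) / (1 / 2 + k) * gamma_quot k"
proof -
  have "1 + k \<notin> \<int>\<^sub>\<le>\<^sub>0"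
  proof
    assume "1 + k \<in> \<int>\<^sub>\<le>\<^sub>0"
    then obtain m where m: "1 + k = - of_nat m" by (auto elim: nonpos_Ints_cases')
    have "2 * k + of_nat (2 * m + 2) = 2 * (1 + k) + 2 * of_nat m" by (simp add: algebra_simps)
    also have "\<dots> = 0" unfolding m by simp
    finally have "2 * k + of_nat (2 * m + 2) = 0" .
    with admissible_nonzero[OF assms, of "2 * m + 2"] show False by simp
  qed
  then have "Gamma (1 + (k + 1)) = (1 + k) * Gamma (1 + k)"
    using Gamma_plus1[of "1 + k"] by (simp add: add_ac)
  moreover have "rGamma (1 / 2 + k) = (1 / 2 + k) * rGamma (1 / 2 + (k + 1))"
    using rGamma_plus1[of "1 / 2 + k"] by (simp add: add_ac)
  moreover have "1 / 2 + k \<noteq> 0"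
    using linear_nonzero(1)[OF assms] by (auto simp: add_eq_0_iff)
  ultimately show ?thesis
    by (simp add: gamma_quot_def field_simps)
qed

lemma pochhammer_shift: "a * pochhammer (a + 1) n = pochhammer a n * (a + of_nat n)"
  for a :: complex
  by (metis mult.commute pochhammer_Suc pochhammer_rec)

text \<open>
  In terms of \<open>m = 2 k + 1\<close> the step \<open>k \<mapsto> k + 1\<close> permutes the parameters \<open>(m + 1) / 4\<close>,
  \<open>(m + 3) / 4\<close> of the numerator and \<open>m / 3\<close>, \<open>(m + 1) / 3\<close>, \<open>(m + 2) / 3\<close> of the denominator up
  to shifts by 1, and it shifts the parameters \<open>(m + 1) / 2\<close>, \<open>m\<close> and \<open>m / 2\<close> by 1 or 2. So all
  rising factorials cancel except for the factors produced by the shifts.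
\<close>

lemma weight_plus_1:
  assumes "admissible k"
  shows "weight n (k + 1) = shift_ratio n k * weight n k"
proof -
  let ?x = "of_nat n :: complex"
  define m where "m = 2 * k + 1"
  have k: "k = (m - 1) / 2" by (simp add: m_def)
  have m: "m \<noteq> 0" "m + 1 \<noteq> 0" "m + 2 * ?x \<noteq> 0" "m + 3 * ?x \<noteq> 0" "m + 1 + 3 * ?x \<noteq> 0"
    using linear_nonzero[OF assms] admissible_nonzero[OF assms, of 2]
    by (auto simp: m_def algebra_simps)
  define a b c d e f where "a = (m + 1) / 2" and "b = m" and "c = (m + 1) / 4" and "d = m / 2"
    and "e = m / 3" and "f = (m + 1) / 3"
  have shift: "pochhammer (z + 1) n = pochhammer z n * (z + ?x) / z" if "z \<noteq> 0" for z
    using pochhammer_shift[of z n] that by (simp add: field_simps)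
  have nz: "a \<noteq> 0" "b \<noteq> 0" "c \<noteq> 0" "d \<noteq> 0" "e \<noteq> 0" "f \<noteq> 0" "b + 1 \<noteq> 0"
    using m by (auto simp: a_def b_def c_def d_def e_def f_def)
  have num: "U_num n k = pochhammer 1 n * pochhammer a n * pochhammer b n * pochhammer (c + 1 / 2) n * pochhammer c n"
    by (simp add: U_num_def a_def b_def c_def k field_simps)
  have num1: "U_num n (k + 1) = pochhammer 1 n * pochhammer (a + 1) n * pochhammer (b + 1 + 1) n
      * pochhammer (c + 1) n * pochhammer (c + 1 / 2) n"
  proof -
    have "1 + (k + 1) = a + 1" "1 + 2 * (k + 1) = b + 1 + 1" "1 + (k + 1) / 2 = c + 1"
      "1 / 2 + (k + 1) / 2 = c + 1 / 2"
      by (simp_all add: a_def b_def c_def k field_simps)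
    then show ?thesis by (simp only: U_num_def)
  qed
  have "1 / 2 + k = d" "1 + 2 * k / 3 = e + 2 / 3" "1 / 3 + 2 * k / 3 = e" "2 / 3 + 2 * k / 3 = f"
    by (simp_all add: d_def e_def f_def k field_simps)
  then have den: "U_den n k = pochhammer (1 / 2) n * pochhammer d n * pochhammer (e + 2 / 3) n * pochhammer e n * pochhammer f n"
    by (simp only: U_den_def)
  have "1 / 2 + (k + 1) = d + 1" "1 + 2 * (k + 1) / 3 = f + 1" "1 / 3 + 2 * (k + 1) / 3 = e + 2 / 3"
    "2 / 3 + 2 * (k + 1) / 3 = e + 1"
    by (simp_all add: d_def e_def f_def k field_simps)
  then have den1: "U_den n (k + 1) = pochhammer (1 / 2) n * pochhammer (d + 1) n * pochhammer (f + 1) n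
      * pochhammer (e + 2 / 3) n * pochhammer (e + 1) n"
    by (simp only: U_den_def)
  have num2: "U_num n (k + 1) = U_num n k
      * (((a + ?x) / a) * ((b + ?x) / b) * ((b + 1 + ?x) / (b + 1)) * ((c + ?x) / c))"
    unfolding num num1 shift[OF nz(1)] shift[OF nz(7)] shift[OF nz(2)] shift[OF nz(3)]
    by (simp add: mult_ac)
  have den2: "U_den n (k + 1) = U_den n k * (((d + ?x) / d) * ((e + ?x) / e) * ((f + ?x) / f))"
    unfolding den den1 shift[OF nz(4)] shift[OF nz(5)] shift[OF nz(6)]
    by (simp add: mult_ac)
  have nz': "d + ?x \<noteq> 0" "e + ?x \<noteq> 0" "f + ?x \<noteq> 0"
    using m by (auto simp: d_def e_def f_def field_simps)
  have "1 + k = a" "1 / 2 + k = d"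
    by (simp_all add: a_def d_def k field_simps)
  then have g: "(gamma_quot (k + 1))\<^sup>2 = (a / d)\<^sup>2 * (gamma_quot k)\<^sup>2"
    unfolding gamma_quot_plus_1[OF assms] by (simp only: power_mult_distrib)
  have "shift_ratio n k = (((a + ?x) / a) * ((b + ?x) / b) * ((b + 1 + ?x) / (b + 1)) * ((c + ?x) / c))
     / (((d + ?x) / d) * ((e + ?x) / e) * ((f + ?x) / f)) * (a / d)\<^sup>2"
  proof -
    have 1: "shift_ratio n k = ((m + 1 + 2 * ?x) * (m + ?x) * (m + 1 + ?x) * (m + 1 + 4 * ?x))
       / (m * (m + 2 * ?x) * (m + 3 * ?x) * (m + 1 + 3 * ?x))"
    proof -
      have "1 + k + ?x = (m + 1 + 2 * ?x) / 2" "1 + 2 * k + ?x = m + ?x" "2 + 2 * k + ?x = m + 1 + ?x"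
        "1 + k + 2 * ?x = (m + 1 + 4 * ?x) / 2" "2 * k + 1 = m" "2 * ?x + 2 * k + 1 = m + 2 * ?x"
        "3 * ?x + 2 * k + 1 = m + 3 * ?x" "3 * ?x + 2 * k + 2 = m + 1 + 3 * ?x"
        by (simp_all add: k field_simps)
      then show ?thesis unfolding shift_ratio_def by (simp only:) (simp add: mult_ac)
    qed
    have quot: "(u / t + ?x) / (u / t) = (u + t * ?x) / u" if "t \<noteq> 0" for u t
      using that by (cases "u = 0") (simp_all add: divide_simps mult_ac)
    have 2: "(a + ?x) / a = (m + 1 + 2 * ?x) / (m + 1)" "(b + ?x) / b = (m + ?x) / m"
      "(b + 1 + ?x) / (b + 1) = (m + 1 + ?x) / (m + 1)" "(c + ?x) / c = (m + 1 + 4 * ?x) / (m + 1)"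
      "(d + ?x) / d = (m + 2 * ?x) / m" "(e + ?x) / e = (m + 3 * ?x) / m"
      "(f + ?x) / f = (m + 1 + 3 * ?x) / (m + 1)"
      unfolding a_def b_def c_def d_def e_def f_def by (simp_all only: quot) simp_all
    have 3: "a / d = (m + 1) / m"
      using m by (simp add: a_def d_def field_simps)
    have "A1 * A2 * A3 * A4 / (p * B1 * B2 * B3)
      = (A1 / q * (A2 / p) * (A3 / q) * (A4 / q)) / (B1 / p * (B2 / p) * (B3 / q)) * (q / p)\<^sup>2"
      if "p \<noteq> 0" "q \<noteq> 0" "B1 \<noteq> 0" "B2 \<noteq> 0" "B3 \<noteq> 0" for A1 A2 A3 A4 p q B1 B2 B3 :: complex
      using that by (simp add: divide_simps power2_eq_square)
    from this[OF m] show ?thesis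
      unfolding 1 2 3 .
  qed
  then show ?thesis
    unfolding weight_def U_def cpochhammer_quot g num2 den2 by (simp add: mult_ac)
qed

lemma wz_polynomial_identity:
  fixes x k :: complex
  shows "4 * ((1 + k + x) * (1 + 2 * k + x) * (2 + 2 * k + x) * (1 + k + 2 * x))
      * (22 * x ^ 3 + (34 * (k + 1) + 49) * x ^ 2 + (12 * (k + 1) ^ 2 + 48 * (k + 1) + 35) * x + 8 * (k + 2) ^ 2)
    - (22 * x ^ 3 + (34 * k + 49) * x ^ 2 + (12 * k ^ 2 + 48 * k + 35) * x + 8 * (k + 1) ^ 2)
      * ((2 * k + 1) * (2 * x + 2 * k + 3) * (3 * x + 2 * k + 4) * (3 * x + 2 * k + 5))
    = - 16 * ((x + 1) * (x + 1 + k) * (x + 1 + 2 * k) * (2 * x + 2 + k) * (2 * x + 1 + k))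
        * ((x + 1) * (4 * x + 4 * k + 7))
      + x * (4 * x + 4 * k + 3) * ((2 * x + 1) * (2 * x + 2 * k + 3) * (3 * x + 2 * k + 3)
        * (3 * x + 2 * k + 4) * (3 * x + 2 * k + 5))"
  by (simp add: algebra_simps eval_nat_numeral)

text \<open>
  The passage from the polynomial to the rational form of the Wilf-Zeilberger equation, with the
  linear factors as independent variables so that clearing denominators never expands them.
\<close>

lemma wz_rational_identity:
  fixes V N P0 P1 a b c e d1 d2 d3 d4 d5 p q :: complex
  assumes "a \<noteq> 0" "b \<noteq> 0" "c \<noteq> 0" "e \<noteq> 0" "d1 \<noteq> 0" "d2 \<noteq> 0" "d3 \<noteq> 0" "d4 \<noteq> 0" "d5 \<noteq> 0"
    and "4 * V * P1 - P0 * (a * c * d4 * d5) = - 16 * N * q + p * (e * c * d3 * d4 * d5)"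
  shows "4 * V / (a * b * d1 * d2) * (P1 / (2 * e * d5 * c * d3 * d4)) - P0 / (2 * e * d3 * b * d1 * d2)
    = 16 * N / (e * b * d1 * d2 * d3) * (- q / (2 * a * c * d4 * d5)) - (- p / (2 * a * b * d1 * d2))"
proof -
  let ?D = "2 * a * b * c * e * d1 * d2 * d3 * d4 * d5"
  have "4 * V / (a * b * d1 * d2) * (P1 / (2 * e * d5 * c * d3 * d4)) - P0 / (2 * e * d3 * b * d1 * d2)
     = (4 * V * P1 - P0 * (a * c * d4 * d5)) / ?D"
    using assms(1-9) by (simp add: divide_simps)
  also have "\<dots> = (- 16 * N * q + p * (e * c * d3 * d4 * d5)) / ?D"
    using assms by simp
  also have "\<dots> = 16 * N / (e * b * d1 * d2 * d3) * (- q / (2 * a * c * d4 * d5)) - (- p / (2 * a * b * d1 * d2))"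
    using assms(1-9) by (simp add: divide_simps)
  finally show ?thesis .
qed

lemma wz_equation:
  assumes "admissible k"
  shows "G n (k + 1) - G n k
    = weight (Suc n) k * certificate (Suc n) k - weight n k * certificate n k"
proof -
  let ?x = "of_nat n :: complex"
  note nz = linear_nonzero[OF assms]
  have "shift_ratio n k * R n (k + 1) - R n k = weight_ratio n k * certificate (Suc n) k - certificate n k"
  proof -
    have R1: "R n (k + 1) = (22 * ?x ^ 3 + (34 * (k + 1) + 49) * ?x ^ 2 + (12 * (k + 1) ^ 2 + 48 * (k + 1) + 35) * ?x + 8 * (k + 2) ^ 2)
      / (2 * (2 * ?x + 1) * (3 * ?x + 2 * k + 5) * (2 * ?x + 2 * k + 3) * (3 * ?x + 2 * k + 3) * (3 * ?x + 2 * k + 4))"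
      by (simp add: R_def R_num_def R_den_def algebra_simps)
    have R0: "R n k = (22 * ?x ^ 3 + (34 * k + 49) * ?x ^ 2 + (12 * k ^ 2 + 48 * k + 35) * ?x + 8 * (k + 1) ^ 2)
      / (2 * (2 * ?x + 1) * (3 * ?x + 2 * k + 3) * (2 * ?x + 2 * k + 1) * (3 * ?x + 2 * k + 1) * (3 * ?x + 2 * k + 2))"
      by (simp add: R_def R_num_def R_den_def add_ac)
    have C1: "certificate (Suc n) k = - ((?x + 1) * (4 * ?x + 4 * k + 7))
      / (2 * (2 * k + 1) * (2 * ?x + 2 * k + 3) * (3 * ?x + 2 * k + 4) * (3 * ?x + 2 * k + 5))"
      by (simp add: certificate_def algebra_simps)
    show ?thesis
      unfolding R1 R0 C1 weight_ratio_def shift_ratio_def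
      unfolding certificate_def
      by (rule wz_rational_identity[OF nz(1) nz(2) nz(8) nz(6) nz(3) nz(4) nz(5) nz(9) nz(10) wz_polynomial_identity])
  qed
  note identity = this
  have "G j z = weight j z * R j z" for j z
    by (simp add: G_def weight_def)
  then have "G n (k + 1) - G n k = weight n k * (shift_ratio n k * R n (k + 1) - R n k)"
    by (simp add: weight_plus_1[OF assms] right_diff_distrib mult_ac)
  also have "\<dots> = weight (Suc n) k * certificate (Suc n) k - weight n k * certificate n k"
    unfolding identity weight_Suc by (simp add: right_diff_distrib mult_ac)
  finally show ?thesis .
qed

section \<open>Periodicity of the sum\<close>

lemma linear_fractional_LIMSEQ:
  fixes a b c d :: complex
  assumes "c \<noteq> 0"
  shows "(\<lambda>n. (a * of_nat n + b) / (c * of_nat n + d)) \<longlonglongrightarrow> a / c"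
proof -
  have "(\<lambda>n. (a + b * inverse (of_nat n)) / (c + d * inverse (of_nat n))) \<longlonglongrightarrow> (a + b * 0) / (c + d * 0)"
    using assms by (intro tendsto_intros lim_inverse_n) auto
  moreover have "\<forall>\<^sub>F n in sequentially. (a + b * inverse (of_nat n)) / (c + d * inverse (of_nat n))
      = (a * of_nat n + b) / (c * of_nat n + d)"
    using eventually_gt_at_top[of 0]
  proof eventually_elim
    case (elim n)
    have "a * of_nat n + b = of_nat n * (a + b * inverse (of_nat n))"
      "c * of_nat n + d = of_nat n * (c + d * inverse (of_nat n))"
      using elim by (simp_all add: distrib_left mult.commute)
    then show ?case using elim by simp
  qed
  ultimately show ?thesis by (simp add: tendsto_cong)
qed

lemma weight_ratio_LIMSEQ: "(\<lambda>n. weight_ratio n k) \<longlonglongrightarrow> 16 / 27"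
proof -
  let ?q = "\<lambda>a b c d n. (a * of_nat n + b) / (c * of_nat n + d) :: complex"
  have "weight_ratio n k = 16 * (?q 1 1 2 1 n * ?q 1 (1 + k) 2 (2 * k + 1) n * ?q 1 (1 + 2 * k) 3 (2 * k + 1) n
      * ?q 2 (2 + k) 3 (2 * k + 2) n * ?q 2 (1 + k) 3 (2 * k + 3) n)" for n
    by (simp add: weight_ratio_def add_ac)
  moreover have "(\<lambda>n. 16 * (?q 1 1 2 1 n * ?q 1 (1 + k) 2 (2 * k + 1) n * ?q 1 (1 + 2 * k) 3 (2 * k + 1) n
      * ?q 2 (2 + k) 3 (2 * k + 2) n * ?q 2 (1 + k) 3 (2 * k + 3) n))
     \<longlonglongrightarrow> 16 * (1 / 2 * (1 / 2) * (1 / 3) * (2 / 3) * (2 / 3))"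
    by (intro tendsto_mult tendsto_const linear_fractional_LIMSEQ) auto
  ultimately show ?thesis by simp
qed

lemma weight_LIMSEQ: "(\<lambda>n. weight n k) \<longlonglongrightarrow> 0"
proof -
  have "(\<lambda>n. norm (weight_ratio n k)) \<longlonglongrightarrow> norm (16 / 27 :: complex)"
    by (intro tendsto_norm weight_ratio_LIMSEQ)
  then have "\<forall>\<^sub>F n in sequentially. norm (weight_ratio n k) < 2 / 3"
    by (rule order_tendstoD) simp
  then obtain N where N: "\<And>n. n \<ge> N \<Longrightarrow> norm (weight_ratio n k) < 2 / 3"
    unfolding eventually_sequentially by blast
  have "summable (\<lambda>n. weight n k)"
  proof (rule summable_ratio_test[of "2 / 3" N])
    show "norm (weight (Suc n) k) \<le> 2 / 3 * norm (weight n k)" if "n \<ge> N" for n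
      unfolding weight_Suc norm_mult using N[OF that] by (intro mult_right_mono) auto
  qed simp
  then show ?thesis by (rule summable_LIMSEQ_zero)
qed

lemma certificate_LIMSEQ: "(\<lambda>n. certificate n k) \<longlonglongrightarrow> 0"
proof -
  let ?q = "\<lambda>a b c d n. (a * of_nat n + b) / (c * of_nat n + d) :: complex"
  have "certificate n k = - 1 / (2 * (2 * k + 1)) * (?q 1 0 2 (2 * k + 1) n * ?q 4 (4 * k + 3) 3 (2 * k + 1) n
      * ?q 0 1 3 (2 * k + 2) n)" for n
    by (simp add: certificate_def add_ac)
  moreover have "(\<lambda>n. - 1 / (2 * (2 * k + 1)) * (?q 1 0 2 (2 * k + 1) n * ?q 4 (4 * k + 3) 3 (2 * k + 1) n
      * ?q 0 1 3 (2 * k + 2) n)) \<longlonglongrightarrow> - 1 / (2 * (2 * k + 1)) * (1 / 2 * (4 / 3) * (0 / 3))"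
    by (intro tendsto_mult tendsto_const linear_fractional_LIMSEQ) auto
  ultimately show ?thesis by simp
qed

text \<open>The partial sums at \<open>k + 1\<close> and \<open>k\<close> differ by a telescoping sum that tends to 0.\<close>

lemma G_sums_plus_1_iff:
  assumes "admissible k"
  shows "(\<lambda>n. G n (k + 1)) sums s \<longleftrightarrow> (\<lambda>n. G n k) sums s"
proof -
  let ?F = "\<lambda>n. weight n k * certificate n k"
  have "(\<Sum>n<N. G n (k + 1)) - (\<Sum>n<N. G n k) = ?F N" for N
  proof -
    have "(\<Sum>n<N. G n (k + 1)) - (\<Sum>n<N. G n k) = (\<Sum>n<N. ?F (Suc n) - ?F n)"
      by (simp only: sum_subtractf[symmetric] wz_equation[OF assms])
    also have "\<dots> = ?F N - ?F 0" by (rule sum_lessThan_telescope)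
    finally show ?thesis by (simp add: certificate_def)
  qed
  moreover have "?F \<longlonglongrightarrow> 0 * 0"
    by (intro tendsto_mult weight_LIMSEQ certificate_LIMSEQ)
  ultimately have "(\<lambda>N. (\<Sum>n<N. G n (k + 1)) - (\<Sum>n<N. G n k)) \<longlonglongrightarrow> 0"
    by simp
  then show ?thesis unfolding sums_def by (rule Lim_transform_eq)
qed

lemma G_sums_plus_nat_iff:
  assumes "admissible k"
  shows "(\<lambda>n. G n (k + of_nat j)) sums s \<longleftrightarrow> (\<lambda>n. G n k) sums s"
proof (induction j)
  case (Suc j)
  have "k + of_nat (Suc j) = (k + of_nat j) + 1" by simp
  then show ?case using G_sums_plus_1_iff[OF admissible_plus_nat[OF assms]] Suc by (simp only:)
qed simp

section \<open>Periodic functions of small exponential growth\<close>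

lemma periodic_function_on_strip_eq:
  fixes f :: "complex \<Rightarrow> complex"
  assumes per: "\<And>z. 0 < Re z \<Longrightarrow> Re z < 1 \<Longrightarrow> f (z + 1) = f z"
    and u: "0 < Re u" "Re u < 2" and v: "0 < Re v" "Re v < 2" and uv: "u - v = of_int m"
  shows "f u = f v"
proof -
  have "Re u - Re v = of_int m" using uv by (metis Re_complex_of_real minus_complex.simps(1) of_real_of_int_eq)
  with u v have "\<bar>of_int m :: real\<bar> < 2" by linarith
  then have "m = 0 \<or> m = 1 \<or> m = -1" by linarith
  then consider "u = v" | "u = v + 1" | "v = u + 1"
    using uv by (auto simp: diff_eq_eq add.commute)
  then show ?thesis
  proof cases
    case 2 then show ?thesis using per[of v] u v by auto
  next
    case 3 then show ?thesis using per[of u] u v by auto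
  qed auto
qed

text \<open>
  The function \<open>g (exp (2\<pi>\<i>(z - 1))) = f z\<close> is well defined and holomorphic on the punctured plane.
  The growth condition becomes \<open>\<bar>g w\<bar> \<le> C max (\<bar>w\<bar>, 1/\<bar>w\<bar>)\<^sup>\<alpha>\<close> with \<open>\<alpha> = c / (2\<pi>) < 1\<close>, so
  that 0 is a removable singularity and, by Liouville's theorem for the difference quotient at 0,
  \<open>g\<close> is constant. A strip of width 2 is used because around the branch cut of \<open>Ln\<close> the values of
  \<open>g\<close> are computed by a second branch, whose arguments leave the strip of width 1.
\<close>

lemma periodic_small_growth_imp_constant:
  fixes f :: "complex \<Rightarrow> complex"
  assumes hol: "f holomorphic_on {z. 0 < Re z \<and> Re z < 2}"
    and per: "\<And>z. 0 < Re z \<Longrightarrow> Re z < 1 \<Longrightarrow> f (z + 1) = f z"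
    and growth: "\<And>z. 0 < Re z \<Longrightarrow> Re z < 2 \<Longrightarrow> norm (f z) \<le> C * exp (c * \<bar>Im z\<bar>)"
    and c: "c < 2 * pi"
    and z: "0 < Re z" "Re z < 2"
  shows "f z = f 1"
proof -
  define L where "L w = 1 + w / (2 * of_real pi * \<i>)" for w
  define g where "g w = f (L (Ln w))" for w
  have ReL: "Re (L w) = 1 + Im w / (2 * pi)" and ImL: "Im (L w) = - Re w / (2 * pi)" for w
    by (simp_all add: L_def Re_divide Im_divide power2_eq_square divide_simps)
  have ReL_Ln: "0 < Re (L (Ln w))" "Re (L (Ln w)) < 2" if "w \<noteq> 0" for w
  proof -
    have "- 1 < Im (Ln w) / (2 * pi)" "Im (Ln w) / (2 * pi) < 1"
      using Im_Ln_le_pi[OF that] mpi_less_Im_Ln[OF that] pi_gt_zero by (simp_all add: field_simps)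
    then show "0 < Re (L (Ln w))" "Re (L (Ln w)) < 2" unfolding ReL by linarith+
  qed
  have L_eq: "\<exists>m. L u - L v = of_int m" if eq: "exp u = exp v" for u v
  proof -
    obtain m :: int where "u = v + (of_int (2 * m) * pi) * \<i>"
      using eq unfolding exp_eq by blast
    then have "L u - L v = of_int m" by (simp add: L_def field_simps)
    then show ?thesis by blast
  qed
  have g_hol: "g holomorphic_on (UNIV - {0})"
  proof -
    have "\<exists>f'. (g has_field_derivative f') (at w0)" if w0: "w0 \<noteq> 0" for w0
    proof -
      let ?B = "ball w0 (norm w0)"
      \<comment> \<open>A branch of \<open>Ln\<close> that is continuous around \<open>w0\<close>, even if \<open>w0\<close> is on the branch cut.\<close>
      let ?h = "\<lambda>w. L (Ln (w / w0) + Ln w0)"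
      have pos: "Re (w / w0) > 0" if "w \<in> ?B" for w
      proof -
        have "norm (1 - w / w0) < 1"
        proof -
          have "1 - w / w0 = (w0 - w) / w0" using w0 by (simp add: field_simps)
          then show ?thesis using that w0 by (simp add: norm_divide dist_norm)
        qed
        moreover have "1 - Re (w / w0) \<le> norm (1 - w / w0)"
          using complex_Re_le_cmod[of "1 - w / w0"] by simp
        ultimately show ?thesis by linarith
      qed
      have strip: "0 < Re (?h w) \<and> Re (?h w) < 2" if "w \<in> ?B" for w
      proof -
        have "w / w0 \<noteq> 0" using pos[OF that] by auto
        then have "\<bar>Im (Ln (w / w0))\<bar> < pi / 2" using pos[OF that] Re_Ln_pos_lt by blast
        then have "- 2 * pi < Im (Ln (w / w0)) + Im (Ln w0)" "Im (Ln (w / w0)) + Im (Ln w0) < 2 * pi"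
          using Im_Ln_le_pi[OF w0] mpi_less_Im_Ln[OF w0] pi_gt_zero by linarith+
        then have "- 1 < Im (Ln (w / w0) + Ln w0) / (2 * pi)" "Im (Ln (w / w0) + Ln w0) / (2 * pi) < 1"
          using pi_gt_zero by (simp_all add: field_simps)
        then show ?thesis unfolding ReL by linarith
      qed
      have "(\<lambda>w. Ln (w / w0)) holomorphic_on ?B"
        using pos by (intro holomorphic_intros) (auto simp: complex_nonpos_Reals_iff not_le w0 dest: pos)
      then have "?h holomorphic_on ?B"
        unfolding L_def by (intro holomorphic_on_add holomorphic_on_divide holomorphic_on_const) auto
      then have "(\<lambda>w. f (?h w)) holomorphic_on ?B"
        using strip by (intro holomorphic_on_compose_gen[OF _ hol, unfolded o_def]) auto
      moreover have "g w = f (?h w)" if "w \<in> ?B" for w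
      proof -
        have w: "w \<noteq> 0" using pos[OF that] by auto
        then have "exp (Ln w) = exp (Ln (w / w0) + Ln w0)" using w0 by (simp add: exp_add)
        then obtain m where "L (Ln w) - ?h w = of_int m" using L_eq by blast
        then show ?thesis
          unfolding g_def using periodic_function_on_strip_eq[of f, OF per] strip[OF that] ReL_Ln[OF w] by blast
      qed
      ultimately have "g holomorphic_on ?B" by (metis (no_types, lifting) holomorphic_transform)
      then show ?thesis using w0 by (auto simp: holomorphic_on_open)
    qed
    then show ?thesis by (subst holomorphic_on_open) auto
  qed
  define \<alpha> where "\<alpha> = c / (2 * pi)"
  have \<alpha>: "\<alpha> < 1" using c by (simp add: \<alpha>_def)
  have g_bound: "norm (g w) \<le> C * exp (\<alpha> * \<bar>ln (norm w)\<bar>)" if "w \<noteq> 0" for w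
  proof -
    have "norm (g w) \<le> C * exp (c * \<bar>Im (L (Ln w))\<bar>)"
      unfolding g_def using ReL_Ln[OF that] by (intro growth) auto
    also have "c * \<bar>Im (L (Ln w))\<bar> = \<alpha> * \<bar>ln (norm w)\<bar>"
      using that by (simp add: ImL \<alpha>_def abs_divide)
    finally show ?thesis .
  qed
  have near_0: "((\<lambda>w. (w - 0) * g w) \<longlongrightarrow> 0) (at 0)"
  proof (rule Lim_null_comparison)
    show "\<forall>\<^sub>F w in at 0. norm ((w - 0) * g w) \<le> C * exp ((1 - \<alpha>) * ln (norm w))"
      unfolding eventually_at
    proof (intro exI[of _ 1] conjI ballI impI)
      fix w :: complex assume "w \<noteq> 0 \<and> dist w 0 < 1"
      then have w: "w \<noteq> 0" "norm w < 1" by auto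
      have "norm ((w - 0) * g w) \<le> exp (ln (norm w)) * (C * exp (\<alpha> * \<bar>ln (norm w)\<bar>))"
        using g_bound[OF w(1)] w by (simp add: norm_mult mult_left_mono)
      also have "\<dots> = C * exp ((1 - \<alpha>) * ln (norm w))"
        using w by (simp add: abs_if ln_less_zero left_diff_distrib exp_diff exp_minus divide_inverse)
      finally show "norm ((w - 0) * g w) \<le> C * exp ((1 - \<alpha>) * ln (norm w))" .
    qed auto
    have "filterlim (\<lambda>w::complex. norm w) (at_right 0) (at 0)"
      unfolding filterlim_at by (auto intro!: tendsto_eq_intros simp: eventually_at_filter)
    then have "filterlim (\<lambda>w::complex. ln (norm w)) at_bot (at 0)"
      using filterlim_compose[OF ln_at_0] by blast
    then have "filterlim (\<lambda>w::complex. (1 - \<alpha>) * ln (norm w)) at_bot (at 0)"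
      using \<alpha> by (intro filterlim_tendsto_pos_mult_at_bot[OF tendsto_const]) auto
    then have "((\<lambda>w::complex. exp ((1 - \<alpha>) * ln (norm w))) \<longlongrightarrow> 0) (at 0)"
      using filterlim_compose[OF exp_at_bot] by blast
    then show "((\<lambda>w::complex. C * exp ((1 - \<alpha>) * ln (norm w))) \<longlongrightarrow> 0) (at 0)"
      by (rule tendsto_mult_right_zero)
  qed
  then obtain G where G: "G holomorphic_on UNIV" and Gg: "\<And>w. w \<noteq> 0 \<Longrightarrow> G w = g w"
    using holomorphic_on_extend_lim[OF g_hol] by auto
  define H where "H w = (if w = 0 then deriv G 0 else (G w - G 0) / (w - 0))" for w
  have H_hol: "H holomorphic_on UNIV"
    unfolding H_def[abs_def] using pole_lemma[OF G, of 0] by auto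
  have "(H \<longlongrightarrow> 0) at_infinity"
  proof (rule Lim_null_comparison)
    show "\<forall>\<^sub>F w in at_infinity. norm (H w) \<le> C * exp ((\<alpha> - 1) * ln (norm w)) + norm (G 0) * inverse (norm w)"
      unfolding eventually_at_infinity
    proof (intro exI[of _ 1] allI impI)
      fix w :: complex assume w: "1 \<le> norm w"
      then have w0: "w \<noteq> 0" by auto
      have "norm (H w) \<le> (norm (g w) + norm (G 0)) / norm w"
        using w0 Gg[OF w0] norm_triangle_ineq4[of "g w" "G 0"]
        by (simp add: H_def norm_divide divide_right_mono)
      also have "\<dots> \<le> (C * exp (\<alpha> * \<bar>ln (norm w)\<bar>) + norm (G 0)) / norm w"
        using g_bound[OF w0] by (intro divide_right_mono add_right_mono) auto
      also have "\<dots> = C * (exp (\<alpha> * \<bar>ln (norm w)\<bar>) / exp (ln (norm w))) + norm (G 0) * inverse (norm w)"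
        using w0 by (simp add: divide_inverse distrib_right)
      also have "exp (\<alpha> * \<bar>ln (norm w)\<bar>) / exp (ln (norm w)) = exp ((\<alpha> - 1) * ln (norm w))"
        using w by (simp add: left_diff_distrib exp_diff)
      finally show "norm (H w) \<le> C * exp ((\<alpha> - 1) * ln (norm w)) + norm (G 0) * inverse (norm w)" .
    qed
    have n: "filterlim (\<lambda>w::complex. norm w) at_top at_infinity"
      by (rule filterlim_norm_at_top)
    then have "filterlim (\<lambda>w::complex. ln (norm w)) at_top at_infinity"
      using filterlim_compose[OF ln_at_top] by blast
    then have "filterlim (\<lambda>w::complex. (\<alpha> - 1) * ln (norm w)) at_bot at_infinity"
      using \<alpha> by (intro filterlim_tendsto_neg_mult_at_bot[OF tendsto_const]) auto
    then have "((\<lambda>w::complex. exp ((\<alpha> - 1) * ln (norm w))) \<longlongrightarrow> 0) at_infinity"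
      using filterlim_compose[OF exp_at_bot] by blast
    moreover have "((\<lambda>w::complex. inverse (norm w)) \<longlongrightarrow> 0) at_infinity"
      using filterlim_compose[OF tendsto_inverse_0_at_top n] tendsto_inverse_0_at_top[OF n] by blast
    ultimately show "((\<lambda>w::complex. C * exp ((\<alpha> - 1) * ln (norm w)) + norm (G 0) * inverse (norm w)) \<longlongrightarrow> 0) at_infinity"
      by (intro tendsto_add_zero tendsto_mult_right_zero)
  qed
  then have H0: "H w = 0" for w using Liouville_weak_0[OF H_hol] by blast
  have g_const: "g w = G 0" if "w \<noteq> 0" for w
    using that Gg[OF that] H0[of w] by (simp add: H_def)
  have "f u = G 0" if "0 < Re u" "Re u < 2" for u
  proof -
    let ?t = "2 * of_real pi * \<i> * (u - 1)"
    have "exp (Ln (exp ?t)) = exp ?t" by simp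
    then obtain m where "L (Ln (exp ?t)) - L ?t = of_int m" using L_eq by blast
    moreover have "L ?t = u" by (simp add: L_def)
    ultimately have "f (L (Ln (exp ?t))) = f u"
      using periodic_function_on_strip_eq[of f, OF per] ReL_Ln[of "exp ?t"] that exp_not_eq_zero by metis
    moreover have "g (exp ?t) = G 0" by (rule g_const) simp
    ultimately show ?thesis unfolding g_def by (rule trans[OF sym])
  qed
  from this[OF z] this[of 1] show ?thesis by (metis one_complex.sel(1) one_less_numeral_iff semiring_norm(76) zero_less_one)
qed

section \<open>Estimates\<close>

text \<open>
  Each factor satisfies \<open>\<bar>1/2 + k + j\<bar>\<^sup>2 / \<bar>1 + k + j\<bar>\<^sup>2 \<le> (a + Y) / (a + Y + 1)\<close> with
  \<open>a = Re k + j\<close>, and these bounds telescope. The constant \<open>Y = 1 + 2 (Im k)\<^sup>2\<close> is large enough for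
  all \<open>a \<ge> 0\<close>; that it is only quadratic in \<open>Im k\<close> makes \<open>gamma_quot\<close> grow polynomially.
\<close>

lemma gamma_quot_pochhammer_bound:
  fixes k :: complex
  defines "Y \<equiv> 1 + 2 * (Im k)\<^sup>2"
  assumes "Re k \<ge> 0"
  shows "(norm (pochhammer (1 / 2 + k) n))\<^sup>2 * (Re k + Y + real n)
    \<le> (Re k + Y) * (norm (pochhammer (1 + k) n))\<^sup>2"
proof (induction n)
  case 0
  then show ?case by simp
next
  case (Suc n)
  define a y where "a = Re k + real n" and "y = Im k"
  have a: "a \<ge> 0" using assms(2) by (simp add: a_def)
  have Y: "Y = 1 + 2 * y\<^sup>2" by (simp add: Y_def y_def)
  have n1: "(norm (1 / 2 + k + of_nat n))\<^sup>2 = (a + 1 / 2)\<^sup>2 + y\<^sup>2"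
    by (simp add: cmod_power2 a_def y_def algebra_simps)
  have n2: "(norm (1 + k + of_nat n))\<^sup>2 = (a + 1)\<^sup>2 + y\<^sup>2"
    by (simp add: cmod_power2 a_def y_def algebra_simps)
  have step: "((a + 1 / 2)\<^sup>2 + y\<^sup>2) * (a + Y + 1) \<le> (a + Y) * ((a + 1)\<^sup>2 + y\<^sup>2)"
  proof -
    have "(a + Y) * ((a + 1)\<^sup>2 + y\<^sup>2) - ((a + 1 / 2)\<^sup>2 + y\<^sup>2) * (a + Y + 1)
       = a * (2 * y\<^sup>2 + 3/4) + (1 / 2 + y\<^sup>2 / 2)"
      unfolding Y by (simp add: power2_eq_square algebra_simps)
    moreover have "a * (2 * y\<^sup>2 + 3/4) + (1 / 2 + y\<^sup>2 / 2) \<ge> 0" using a by simp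
    ultimately show ?thesis by linarith
  qed
  have pos: "a + Y > 0" using a Y by (simp add: add_nonneg_pos add_pos_nonneg)
  let ?p = "(norm (pochhammer (1 / 2 + k) n))\<^sup>2" and ?q = "(norm (pochhammer (1 + k) n))\<^sup>2"
  have IH: "?p * (a + Y) \<le> (Re k + Y) * ?q" using Suc by (simp add: a_def algebra_simps)
  have "?p * ((a + 1 / 2)\<^sup>2 + y\<^sup>2) * (a + Y + 1) \<le> ?p * ((a + Y) * ((a + 1)\<^sup>2 + y\<^sup>2))"
    using step by (simp add: mult.assoc mult_left_mono)
  also have "\<dots> = (?p * (a + Y)) * ((a + 1)\<^sup>2 + y\<^sup>2)" by simp
  also have "\<dots> \<le> ((Re k + Y) * ?q) * ((a + 1)\<^sup>2 + y\<^sup>2)"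
    using IH by (intro mult_right_mono) auto
  finally have "?p * ((a + 1 / 2)\<^sup>2 + y\<^sup>2) * (a + Y + 1) \<le> (Re k + Y) * (?q * ((a + 1)\<^sup>2 + y\<^sup>2))"
    by (simp add: mult.assoc)
  then show ?case
    unfolding pochhammer_Suc norm_mult power_mult_distrib n1 n2 by (simp add: a_def add_ac)
qed

text \<open>
  By the product formula of Gauss, \<open>gamma_quot k\<close> is the limit of \<open>sqrt n\<close> times the quotient of the
  rising factorials above, and the square of this quotient is bounded by a multiple of \<open>1 / n\<close>.
\<close>

lemma norm_gamma_quot_bound:
  assumes "Re k \<ge> 0"
  shows "(norm (gamma_quot k))\<^sup>2 \<le> Re k + 1 + 2 * (Im k)\<^sup>2"
proof -
  let ?a = "Re k + 1 + 2 * (Im k)\<^sup>2"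
  have "(\<lambda>n. Gamma_series (1 + k) n * rGamma_series (1 / 2 + k) n) \<longlonglongrightarrow> gamma_quot k"
    unfolding gamma_quot_def by (intro tendsto_intros)
  then have lim: "(\<lambda>n. (norm (Gamma_series (1 + k) n * rGamma_series (1 / 2 + k) n))\<^sup>2) \<longlonglongrightarrow> (norm (gamma_quot k))\<^sup>2"
    by (intro tendsto_intros)
  show ?thesis
  proof (rule tendsto_upperbound[OF lim])
    show "\<forall>\<^sub>F n in sequentially. (norm (Gamma_series (1 + k) n * rGamma_series (1 / 2 + k) n))\<^sup>2 \<le> ?a"
      using eventually_gt_at_top[of 0]
    proof eventually_elim
      case (elim n)
      define e where "e = exp (of_real (ln (of_nat n)) / 2 :: complex)"
      have exp_ne: "exp ((1 / 2 + k) * of_real (ln (of_nat n))) \<noteq> (0::complex)" by simp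
      have "exp ((1 + k) * of_real (ln (of_nat n))) = exp ((1 / 2 + k) * of_real (ln (of_nat n))) * e"
        unfolding e_def exp_add[symmetric] by (simp add: algebra_simps)
      then have eq: "Gamma_series (1 + k) n * rGamma_series (1 / 2 + k) n
         = e * (pochhammer (1 / 2 + k) (n + 1) / pochhammer (1 + k) (n + 1))"
        using exp_ne unfolding Gamma_series_def rGamma_series_def by (simp add: divide_simps)
      have "(norm e)\<^sup>2 = exp (ln (real n))"
        unfolding e_def by (simp flip: exp_double)
      then have e: "(norm e)\<^sup>2 = real n" using elim by simp
      let ?p = "(norm (pochhammer (1 / 2 + k) (n + 1)))\<^sup>2" and ?q = "(norm (pochhammer (1 + k) (n + 1)))\<^sup>2"
      have pos: "?a > 0" using assms by (simp add: add_nonneg_pos add_pos_nonneg)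
      have "?p * real n \<le> ?p * (Re k + (1 + 2 * (Im k)\<^sup>2) + real (n + 1))"
        using assms by (intro mult_left_mono) auto
      also have "\<dots> \<le> ?a * ?q"
        using gamma_quot_pochhammer_bound[OF assms, of "n + 1"] by (simp add: add_ac)
      finally have *: "real n * ?p \<le> ?a * ?q" by (simp add: mult.commute)
      have "real n * (?p / ?q) \<le> ?a"
      proof (cases "?q = 0")
        case False
        then have "?q > 0" by simp
        then show ?thesis using * by (simp add: pos_divide_le_eq)
      qed (use pos in auto)
      then show ?case
        unfolding eq norm_mult norm_divide power_mult_distrib power_divide e .
    qed
  qed simp
qed

lemma norm_le_of_components:
  fixes z w :: complex
  assumes "\<bar>Re z\<bar> \<le> \<bar>Re w\<bar>" "\<bar>Im z\<bar> \<le> \<bar>Im w\<bar>"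
  shows "norm z \<le> norm w"
  unfolding cmod_def using assms by (intro real_sqrt_le_mono add_mono) (simp_all add: abs_le_square_iff)

lemma weight_ratio_factored:
  "weight_ratio n k = 16 / 27 * (((of_nat n + 1) / (of_nat n + 1 / 2))
     * ((of_nat n + 1 + k) / (of_nat n + 1 / 2 + k))
     * ((of_nat n + 1 + 2 * k) / (of_nat n + 1 + 2 * k / 3))
     * ((of_nat n + 1 + k / 2) / (of_nat n + 1 / 3 + 2 * k / 3))
     * ((of_nat n + 1 / 2 + k / 2) / (of_nat n + 2 / 3 + 2 * k / 3)))"
proof -
  let ?x = "of_nat n :: complex"
  have *: "16 * (A * B * C * D * E) / (P * Q * R1 * R2 * R3)
      = 16 / 27 * ((A / p) * (B / q) * (C / r3) * (D' / r1) * (E' / r2))"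
    if "D = 2 * D'" "E = 2 * E'" "P = 2 * p" "Q = 2 * q" "R1 = 3 * r1" "R2 = 3 * r2" "R3 = 3 * r3"
    for A B C D E P Q R1 R2 R3 D' E' p q r1 r2 r3 :: complex
    unfolding that by (simp add: mult_ac)
  show ?thesis
    unfolding weight_ratio_def by (rule *) (simp_all add: algebra_simps)
qed

text \<open>
  Of the five quotients in the factorisation, three are at most \<open>(n + 1) / n\<close> and one at most 1. What
  remains is \<open>(n + 1 + 2 k) / (n + 1 + 2 k / 3)\<close>, which varies between about 1 for large \<open>n\<close> and
  about 3 for large \<open>k\<close> and decides whether the terms decay.
\<close>

lemma norm_weight_ratio_le_of_quotient:
  assumes n: "n \<ge> 1" and k: "Re k > - (1 / 2)"
    and q: "norm (of_nat n + 1 + 2 * k) \<le> q * norm (of_nat n + 1 + 2 * k / 3)"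
  shows "norm (weight_ratio n k) \<le> 16 / 27 * q * ((real n + 1) / real n) ^ 3"
proof -
  let ?x = "of_nat n :: complex"
  define r where "r = (real n + 1) / real n"
  have n': "real n \<ge> 1" using n by simp
  have nR: "real n > 0" using n' by linarith
  have quot: "norm (z / w) \<le> c" if "norm z \<le> c * norm w" "c \<ge> 0" for z w :: complex and c
    using that by (cases "w = 0") (simp_all add: norm_divide pos_divide_le_eq)
  have r0: "r \<ge> 1" using nR by (simp add: r_def field_simps)
  have rn: "r * real n = real n + 1" using nR by (simp add: r_def)
  have b1: "norm ((?x + 1) / (?x + 1 / 2)) \<le> r"
  proof (rule quot)
    have "norm (?x + 1) = real n + 1"
      using norm_of_nat[of "n + 1", where 'a = complex] by (simp add: add.commute)
    also have "\<dots> = r * real n" by (rule rn[symmetric])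
    also have "\<dots> \<le> r * (real n + 1 / 2)"
      using nR r0 by (intro mult_left_mono) auto
    also have "real n + 1 / 2 = norm (?x + 1 / 2)"
    proof -
      have "?x + 1 / 2 = of_real (real n + 1 / 2)" by simp
      then show ?thesis using nR by (simp only: norm_of_real)
    qed
    finally show "norm (?x + 1) \<le> r * norm (?x + 1 / 2)" .
  qed (use r0 in simp)
  have b2: "norm ((?x + 1 + k) / (?x + 1 / 2 + k)) \<le> r"
  proof (rule quot)
    have "norm (?x + 1 + k) = norm ((?x + 1 / 2 + k) + of_real (1 / 2))" by (simp add: algebra_simps)
    also have "\<dots> \<le> norm (?x + 1 / 2 + k) + 1 / 2"
      using norm_triangle_ineq[of "?x + 1 / 2 + k" "of_real (1 / 2)"] by simp
    also have "\<dots> \<le> norm (?x + 1 / 2 + k) + norm (?x + 1 / 2 + k) / real n"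
    proof -
      have "real n \<le> norm (?x + 1 / 2 + k)"
        using complex_Re_le_cmod[of "?x + 1 / 2 + k"] k by simp
      then have "1 \<le> norm (?x + 1 / 2 + k) / real n" using nR by simp
      then show ?thesis by linarith
    qed
    also have "\<dots> = r * norm (?x + 1 / 2 + k)" using nR by (simp add: r_def field_simps)
    finally show "norm (?x + 1 + k) \<le> r * norm (?x + 1 / 2 + k)" .
  qed (use r0 in simp)
  have pos: "norm (?x + 1 + 2 * k / 3) > 0"
  proof -
    have "Re (?x + 1 + 2 * k / 3) > 0" using k nR by simp
    then show ?thesis using complex_Re_le_cmod[of "?x + 1 + 2 * k / 3"] by linarith
  qed
  have q0: "q \<ge> 0"
    using q pos by (meson norm_ge_zero order_trans zero_le_mult_iff not_less less_le_trans)
  have b3: "norm ((?x + 1 + 2 * k) / (?x + 1 + 2 * k / 3)) \<le> q"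
    by (rule quot[OF q q0])
  have b4: "norm ((?x + 1 + k / 2) / (?x + 1 / 3 + 2 * k / 3)) \<le> r"
  proof (rule quot)
    have "norm (?x + 1 + k / 2) \<le> norm (of_real r * (?x + 1 / 3 + 2 * k / 3))"
    proof (rule norm_le_of_components)
      have "(real n + 1 + Re k / 2) \<le> r * (real n + 1 / 3 + 2 * Re k / 3)"
      proof -
        have "real n + 1 + Re k / 2 \<le> real n + 1 + (1 / 3 + 2 * Re k / 3)"
          using k by simp
        also have "\<dots> \<le> real n + 1 + (1 / 3 + 2 * Re k / 3) + (1 / 3 + 2 * Re k / 3) / real n"
          using k nR by simp
        also have "\<dots> = r * (real n + 1 / 3 + 2 * Re k / 3)"
          using nR by (simp add: r_def field_simps)
        finally show ?thesis .
      qed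
      moreover have "real n + 1 + Re k / 2 \<ge> 0" using k nR by linarith
      moreover have "Re (?x + 1 + k / 2) = real n + 1 + Re k / 2" by simp
      moreover have "Re (of_real r * (?x + 1 / 3 + 2 * k / 3)) = r * (real n + 1 / 3 + 2 * Re k / 3)"
        by (simp only: Re_complex_of_real Re_complex_div_gt_0 times_complex.simps Im_complex_of_real) simp
      ultimately show "\<bar>Re (?x + 1 + k / 2)\<bar> \<le> \<bar>Re (of_real r * (?x + 1 / 3 + 2 * k / 3))\<bar>"
        by linarith
      have "1 * (2 / 3 * \<bar>Im k\<bar>) \<le> r * (2 / 3 * \<bar>Im k\<bar>)" using r0 by (intro mult_right_mono) auto
      also have "\<dots> = \<bar>Im (of_real r * (?x + 1 / 3 + 2 * k / 3))\<bar>"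
        using r0 by (simp add: abs_mult)
      finally show "\<bar>Im (?x + 1 + k / 2)\<bar> \<le> \<bar>Im (of_real r * (?x + 1 / 3 + 2 * k / 3))\<bar>" by simp
    qed
    then show "norm (?x + 1 + k / 2) \<le> r * norm (?x + 1 / 3 + 2 * k / 3)"
      using r0 by (simp only: norm_mult norm_of_real)
  qed (use r0 in simp)
  have b5: "norm ((?x + 1 / 2 + k / 2) / (?x + 2 / 3 + 2 * k / 3)) \<le> 1"
  proof (rule quot)
    show "norm (?x + 1 / 2 + k / 2) \<le> 1 * norm (?x + 2 / 3 + 2 * k / 3)"
      unfolding mult_1 using k nR by (intro norm_le_of_components) auto
  qed simp
  have "norm (weight_ratio n k) \<le> 16 / 27 * (r * r * q * r * 1)"
    unfolding weight_ratio_factored norm_mult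
    by (intro mult_mono b1 b2 b3 b4 b5 mult_nonneg_nonneg norm_ge_zero q0) (use r0 q0 in auto)
  then show ?thesis unfolding r_def by (simp add: power3_eq_cube mult_ac)
qed

lemma norm_weight_ratio_le:
  assumes "n \<ge> 1" "Re k > - (1 / 2)"
  shows "norm (weight_ratio n k) \<le> 16 / 9 * ((real n + 1) / real n) ^ 3"
proof -
  have "norm (of_nat n + 1 + 2 * k) \<le> norm (3 * (of_nat n + 1 + 2 * k / 3))"
    using assms by (intro norm_le_of_components) auto
  then have "norm (of_nat n + 1 + 2 * k) \<le> 3 * norm (of_nat n + 1 + 2 * k / 3)"
    by (simp only: norm_mult) simp
  from norm_weight_ratio_le_of_quotient[OF assms this] show ?thesis by simp
qed

text \<open>
  With \<open>m = n + 1 \<ge> 2 \<bar>Im k\<bar>\<close> the critical quotient is at most \<open>3/2\<close>, and \<open>16/27 * 3/2 = 8/9\<close>. After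
  squaring, \<open>3 (Im k)\<^sup>2\<close> takes \<open>3/4 m\<^sup>2\<close> of the available \<open>5/4 m\<^sup>2\<close>; the bound \<open>m \<ge> 8\<close> lets the rest
  absorb the terms that come from \<open>Re k \<le> 2\<close>.
\<close>

lemma norm_weight_ratio_le_late:
  assumes n: "n + 1 \<ge> 8" "real n + 1 \<ge> 2 * \<bar>Im k\<bar>" and k: "Re k > - (1 / 2)" "Re k \<le> 2"
  shows "norm (weight_ratio n k) \<le> 8 / 9 * ((real n + 1) / real n) ^ 3"
proof -
  define m s y where "m = real n + 1" and "s = Re k" and "y = Im k"
  have m: "m \<ge> 8" using n(1) by (simp add: m_def)
  have "(norm (of_nat n + 1 + 2 * k))\<^sup>2 \<le> (3 / 2 * norm (of_nat n + 1 + 2 * k / 3))\<^sup>2"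
  proof -
    have l: "(norm (of_nat n + 1 + 2 * k))\<^sup>2 = (m + 2 * s)\<^sup>2 + (2 * y)\<^sup>2"
      and r: "(norm (of_nat n + 1 + 2 * k / 3))\<^sup>2 = (m + 2 * s / 3)\<^sup>2 + (2 * y / 3)\<^sup>2"
      by (simp_all add: cmod_power2 m_def s_def y_def)
    have y: "4 * y\<^sup>2 \<le> m\<^sup>2"
      using n(2) power_mono[of "2 * \<bar>y\<bar>" m 2] by (simp add: m_def y_def power_mult_distrib)
    have "m * s \<le> m * 2" using k m by (intro mult_left_mono) (auto simp: s_def)
    moreover have "\<bar>s\<bar> \<le> \<bar>2\<bar>" using k by (auto simp: s_def)
    then have "s\<^sup>2 \<le> 4" unfolding abs_le_square_iff by simp
    moreover have "8 * m \<le> m * m" using m by (intro mult_right_mono) auto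
    ultimately have "0 \<le> 5 / 4 * (m * m) - m * s - 3 * s\<^sup>2 - 3 * y\<^sup>2"
      using y m power2_eq_square[of m] by linarith
    also have "\<dots> = (9 / 4) * ((m + 2 * s / 3)\<^sup>2 + (2 * y / 3)\<^sup>2) - ((m + 2 * s)\<^sup>2 + (2 * y)\<^sup>2)"
      by (simp add: power2_eq_square field_simps)
    finally have "(m + 2 * s)\<^sup>2 + (2 * y)\<^sup>2 \<le> (9 / 4) * ((m + 2 * s / 3)\<^sup>2 + (2 * y / 3)\<^sup>2)"
      by simp
    then show ?thesis unfolding power_mult_distrib l r by (simp add: power2_eq_square)
  qed
  then have "norm (of_nat n + 1 + 2 * k) \<le> 3 / 2 * norm (of_nat n + 1 + 2 * k / 3)"
    by (rule power2_le_imp_le) simp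
  from norm_weight_ratio_le_of_quotient[OF _ k(1) this] show ?thesis using n by simp
qed

text \<open>
  The cubes \<open>((n + 1) / n)\<^sup>3\<close> telescope, and each of the first \<open>M\<close> steps has the ratio \<open>16/9\<close> instead
  of \<open>8/9\<close>. Starting at \<open>weight 1 k\<close> and not at \<open>weight 0 k\<close> keeps the estimate valid up to the line
  \<open>Re k = -1/2\<close>, where \<open>weight_ratio 0 k\<close> has a pole.
\<close>

lemma norm_weight_le:
  fixes k :: complex
  defines "M \<equiv> 7 + nat \<lceil>2 * \<bar>Im k\<bar>\<rceil>"
  assumes k: "Re k > - (1 / 2)" "Re k \<le> 2"
  shows "norm (weight (Suc n) k) \<le> norm (weight 1 k) * real (Suc n) ^ 3 * (8 / 9) ^ n * 2 ^ min (Suc n) M"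
proof (induction n)
  case 0
  have "norm (weight 1 k) * 1 \<le> norm (weight 1 k) * 2 ^ min (Suc 0) M"
    by (intro mult_left_mono) auto
  then show ?case by simp
next
  case (Suc n)
  let ?m = "Suc n"
  let ?W = "norm (weight 1 k)"
  have cube: "((real ?m + 1) / real ?m) ^ 3 * real ?m ^ 3 = real (Suc ?m) ^ 3"
    by (simp add: power_divide add_ac)
  have ratio: "norm (weight_ratio ?m k) * 2 ^ min ?m M \<le> 8 / 9 * ((real ?m + 1) / real ?m) ^ 3 * 2 ^ min (Suc ?m) M"
  proof (cases "?m < M")
    case True
    have "norm (weight_ratio ?m k) * 2 ^ min ?m M \<le> 16 / 9 * ((real ?m + 1) / real ?m) ^ 3 * 2 ^ min ?m M"
      using k by (intro mult_right_mono norm_weight_ratio_le) auto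
    also have "\<dots> = 8 / 9 * ((real ?m + 1) / real ?m) ^ 3 * (2 * 2 ^ min ?m M)" by simp
    also have "2 * 2 ^ min ?m M = (2 :: real) ^ min (Suc ?m) M" using True by (simp add: min_def)
    finally show ?thesis .
  next
    case False
    then have M: "7 + nat \<lceil>2 * \<bar>Im k\<bar>\<rceil> \<le> ?m" by (simp add: M_def)
    then have m: "?m + 1 \<ge> 8" by simp
    have "2 * \<bar>Im k\<bar> \<le> real (nat \<lceil>2 * \<bar>Im k\<bar>\<rceil>)" by (rule real_nat_ceiling_ge)
    also have "\<dots> \<le> real ?m + 1" using M by linarith
    finally have "norm (weight_ratio ?m k) \<le> 8 / 9 * ((real ?m + 1) / real ?m) ^ 3"
      using m k by (intro norm_weight_ratio_le_late) auto
    moreover have "min (Suc ?m) M = min ?m M" using False by simp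
    ultimately show ?thesis by (simp only:) (intro mult_right_mono, auto)
  qed
  have "norm (weight (Suc ?m) k) = norm (weight_ratio ?m k) * norm (weight ?m k)"
    by (simp add: weight_Suc norm_mult)
  also have "\<dots> \<le> norm (weight_ratio ?m k) * (?W * real ?m ^ 3 * (8 / 9) ^ n * 2 ^ min ?m M)"
    by (intro mult_left_mono Suc.IH) auto
  also have "\<dots> = (?W * real ?m ^ 3 * (8 / 9) ^ n) * (norm (weight_ratio ?m k) * 2 ^ min ?m M)"
    by (simp only: mult_ac)
  also have "\<dots> \<le> (?W * real ?m ^ 3 * (8 / 9) ^ n) * (8 / 9 * ((real ?m + 1) / real ?m) ^ 3 * 2 ^ min (Suc ?m) M)"
    by (intro mult_left_mono ratio) auto
  also have "\<dots> = ?W * (((real ?m + 1) / real ?m) ^ 3 * real ?m ^ 3) * (8 / 9) ^ Suc n * 2 ^ min (Suc ?m) M"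
    by (simp only: mult_ac power_Suc)
  finally show ?case unfolding cube .
qed

text \<open>
  The numerator is a combination of monomials of degree at most 3 in \<open>n\<close>, \<open>k\<close> and \<open>k + 1\<close>, and each
  of three linear factors of the denominator dominates 1, \<open>n\<close>, \<open>k\<close> and \<open>k + 1\<close>.
\<close>

lemma norm_R_le:
  assumes n: "n \<ge> 1" and k: "Re k > - (1 / 2)"
  shows "norm (R n k) \<le> 208"
proof -
  let ?x = "of_nat n :: complex"
  have n': "real n \<ge> 1" using n by simp
  define d1 d2 d3 d4 where "d1 = 3 + 2 * k + 3 * ?x" and "d2 = 2 * ?x + 2 * k + 1"
    and "d3 = 3 * ?x + 2 * k + 1" and "d4 = 3 * ?x + 2 * k + 2"
  define p where "p = norm d1 * norm d2 * norm d3"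
  have le: "norm k \<le> norm d" "real n \<le> norm d" "1 \<le> norm d" "norm (k + 1) \<le> norm d" if "d \<in> {d1, d2, d3}" for d
  proof -
    have d: "real n + 2 * Re k + 1 \<le> Re d - real n" "Im d = 2 * Im k"
      using that n' by (auto simp: d1_def d2_def d3_def)
    show "norm k \<le> norm d" "norm (k + 1) \<le> norm d"
      using d n' k by (intro norm_le_of_components; simp add: abs_if; linarith)+
    show "real n \<le> norm d" using d n' k complex_Re_le_cmod[of d] by linarith
    then show "1 \<le> norm d" using n' by linarith
  qed
  define dominated where "dominated a \<longleftrightarrow> (\<forall>d\<in>{d1, d2, d3}. norm a \<le> norm d)" for a :: complex
  have dom: "dominated ?x" "dominated k" "dominated 1" "dominated (k + 1)"
    unfolding dominated_def using le by (simp_all only: norm_of_nat norm_one ball_simps) blast+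
  have prod: "norm (of_real c * (u * v * w)) \<le> c * p"
    if "dominated u" "dominated v" "dominated w" "c \<ge> 0" for u v w c
  proof -
    have "norm u * norm v * norm w \<le> p"
      using that unfolding p_def dominated_def by (intro mult_mono mult_nonneg_nonneg norm_ge_zero) blast+
    then show ?thesis using that(4) by (simp add: norm_mult mult_left_mono)
  qed
  have num: "norm (R_num n k) \<le> 208 * p"
  proof -
    have "R_num n k = of_real 22 * (?x * ?x * ?x) + of_real 34 * (k * ?x * ?x) + of_real 49 * (1 * ?x * ?x)
        + of_real 12 * (k * k * ?x) + of_real 48 * (k * 1 * ?x) + of_real 35 * (1 * 1 * ?x)
        + of_real 8 * ((k + 1) * (k + 1) * 1)"
      by (simp add: R_num_def algebra_simps eval_nat_numeral)
    also have "norm \<dots> \<le> 22 * p + 34 * p + 49 * p + 12 * p + 48 * p + 35 * p + 8 * p"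
      by (intro norm_triangle_mono prod dom) simp_all
    also have "\<dots> \<le> 208 * p" by (simp add: p_def)
    finally show ?thesis .
  qed
  have den: "p \<le> norm (R_den n k)"
  proof -
    have "norm (1 + 2 * ?x) \<ge> 1"
      using complex_Re_le_cmod[of "1 + 2 * ?x"] by simp
    moreover have "norm d4 \<ge> 1"
      using complex_Re_le_cmod[of d4] n' k by (simp add: d4_def)
    ultimately have "1 * 1 \<le> 2 * norm (1 + 2 * ?x) * norm d4" by (intro mult_mono) auto
    then have "1 * p \<le> (2 * norm (1 + 2 * ?x) * norm d4) * p"
      by (intro mult_right_mono) (simp_all add: p_def)
    also have "\<dots> = norm (R_den n k)"
      unfolding R_den_def d1_def[symmetric] d2_def[symmetric] d3_def[symmetric] d4_def[symmetric] norm_mult p_def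
      by simp
    finally show ?thesis by simp
  qed
  have "1 * 1 * 1 \<le> p"
    unfolding p_def using le(3)[of d1] le(3)[of d2] le(3)[of d3]
    by (intro mult_mono mult_nonneg_nonneg norm_ge_zero) simp_all
  then have "norm (R_den n k) > 0" using den by linarith
  moreover have "norm (R_num n k) \<le> 208 * norm (R_den n k)" using num den by linarith
  ultimately show ?thesis unfolding R_def norm_divide by (simp only: pos_divide_le_eq)
qed

text \<open>
  \<open>59904 = 208 * 2\<^sup>8 * 9/8\<close>: the bound for \<open>R\<close>, the part of \<open>2\<^sup>M\<close> in \<open>norm_weight_le\<close> that is not
  absorbed by \<open>exp (2 \<bar>Im k\<bar>)\<close>, and the step from the exponent \<open>n - 1\<close> of \<open>8/9\<close> to \<open>n\<close>.
\<close>

definition majorant :: "nat \<Rightarrow> real" where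
  "majorant n = 59904 * (real (Suc n) ^ 3 * (8 / 9) ^ n)"

lemma majorant_ge: "majorant n \<ge> 0"
  by (simp add: majorant_def)

lemma summable_majorant: "summable majorant"
proof -
  have "(\<lambda>n. 1 + inverse (real (Suc n))) \<longlonglongrightarrow> 1 + 0"
    by (intro tendsto_add tendsto_const LIMSEQ_inverse_real_of_nat)
  also have "(\<lambda>n. 1 + inverse (real (Suc n))) = (\<lambda>n. (real n + 2) / (real n + 1))"
    by (simp add: field_simps)
  finally have lim: "(\<lambda>n. 8 / 9 * ((real n + 2) / (real n + 1)) ^ 3) \<longlonglongrightarrow> 8 / 9 * (1 + 0) ^ 3"
    by (intro tendsto_intros)
  have "\<forall>\<^sub>F n in sequentially. 8 / 9 * ((real n + 2) / (real n + 1)) ^ 3 < 9 / 10"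
    by (rule order_tendstoD[OF lim]) simp
  then obtain N where N: "\<And>n. n \<ge> N \<Longrightarrow> 8 / 9 * ((real n + 2) / (real n + 1)) ^ 3 < 9 / 10"
    unfolding eventually_sequentially by blast
  show ?thesis
  proof (rule summable_ratio_test[of "9 / 10" N])
    fix n assume "n \<ge> N"
    have "majorant (Suc n) = (8 / 9 * ((real n + 2) / (real n + 1)) ^ 3) * majorant n"
      by (simp add: majorant_def power_divide add_ac)
    also have "\<dots> \<le> 9 / 10 * majorant n"
      using N[OF \<open>n \<ge> N\<close>] majorant_ge by (intro mult_right_mono) auto
    finally show "norm (majorant (Suc n)) \<le> 9 / 10 * norm (majorant n)"
      using majorant_ge by simp
  qed simp
qed

lemma norm_G_le:
  assumes n: "n \<ge> 1" and k: "Re k > - (1 / 2)" "Re k \<le> 2"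
  shows "norm (G n k) \<le> norm (weight 1 k) * exp (2 * \<bar>Im k\<bar>) * majorant n"
proof -
  obtain m where m: "n = Suc m" using n by (cases n) auto
  let ?M = "7 + nat \<lceil>2 * \<bar>Im k\<bar>\<rceil>"
  have "(2::real) ^ min n ?M \<le> 2 ^ ?M" by (intro power_increasing) auto
  also have "\<dots> = 128 * 2 ^ nat \<lceil>2 * \<bar>Im k\<bar>\<rceil>" by (simp add: power_add)
  also have "(2::real) ^ nat \<lceil>2 * \<bar>Im k\<bar>\<rceil> = 2 powr real (nat \<lceil>2 * \<bar>Im k\<bar>\<rceil>)"
    by (rule powr_realpow[symmetric]) simp
  also have "\<dots> \<le> 2 powr (2 * \<bar>Im k\<bar> + 1)"
    by (intro powr_mono) (auto simp: of_nat_nat ceiling_correct less_imp_le)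
  also have "\<dots> = 2 * 2 powr (2 * \<bar>Im k\<bar>)" by (simp add: powr_add)
  also have "2 powr (2 * \<bar>Im k\<bar>) \<le> exp 1 powr (2 * \<bar>Im k\<bar>)"
    using exp_ge_add_one_self[of 1] by (intro powr_mono2) auto
  also have "\<dots> = exp (2 * \<bar>Im k\<bar>)" by (simp add: powr_def)
  finally have two: "(2::real) ^ min n ?M \<le> 256 * exp (2 * \<bar>Im k\<bar>)" by simp
  have "norm (G n k) = norm (weight n k) * norm (R n k)"
    by (simp add: G_def weight_def norm_mult mult_ac)
  also have "\<dots> \<le> (norm (weight 1 k) * real n ^ 3 * (8 / 9) ^ m * 2 ^ min n ?M) * 208"
    using norm_weight_le[OF k, of m] norm_R_le[OF n k(1)] unfolding m[symmetric]
    by (intro mult_mono) auto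
  also have "\<dots> \<le> (norm (weight 1 k) * real n ^ 3 * (8 / 9) ^ m * (256 * exp (2 * \<bar>Im k\<bar>))) * 208"
    by (intro mult_mono two mult_nonneg_nonneg) auto
  also have "\<dots> = norm (weight 1 k) * exp (2 * \<bar>Im k\<bar>) * (53248 * (real n ^ 3 * (8 / 9) ^ m))" by simp
  also have "\<dots> \<le> norm (weight 1 k) * exp (2 * \<bar>Im k\<bar>) * majorant n"
  proof (intro mult_left_mono)
    have "53248 * (real n ^ 3 * (8 / 9) ^ m) = 59904 * (real n ^ 3 * (8 / 9) ^ n)" by (simp add: m)
    also have "\<dots> \<le> 59904 * (real (Suc n) ^ 3 * (8 / 9) ^ n)"
      by (intro mult_mono power_mono) auto
    finally show "53248 * (real n ^ 3 * (8 / 9) ^ m) \<le> majorant n" by (simp add: majorant_def)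
  qed auto
  finally show ?thesis .
qed

text \<open>\<open>gamma_quot\<close> without its zero at \<open>k = -1/2\<close>.\<close>

definition gamma_quot_shifted :: "complex \<Rightarrow> complex" where
  "gamma_quot_shifted k = Gamma (1 + k) * rGamma (3 / 2 + k)"

lemma gamma_quot_eq_shifted: "gamma_quot k = (2 * k + 1) / 2 * gamma_quot_shifted k"
  using rGamma_plus1[of "1 / 2 + k"]
  by (simp add: gamma_quot_def gamma_quot_shifted_def add_ac field_simps)

lemma weight_0: "weight 0 k = of_real pi * (gamma_quot k)\<^sup>2"
  by (simp add: weight_def U_def U_num_def U_den_def cpochhammer_quot)

lemma weight_1:
  assumes "admissible k"
  shows "weight 1 k = 8 * (1 + k) * (2 + k) / ((2 * k + 1) * (2 * k + 3)) * (of_real pi * (gamma_quot k)\<^sup>2)"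
proof -
  have nz: "2 * k + 1 \<noteq> 0" "1 + k \<noteq> 0" "2 * k + 3 \<noteq> 0"
    using linear_nonzero[OF assms] admissible_nonzero[OF assms, of 3] by auto
  have cancel: "16 * (a * p * b * a) / (p * p * (2 * a) * q) = 8 * a * b / (p * q)"
    if "a \<noteq> 0" "p \<noteq> 0" for a b p q :: complex
    using that by simp
  have "weight_ratio 0 k = 16 * ((1 + k) * (2 * k + 1) * (2 + k) * (1 + k))
      / ((2 * k + 1) * (2 * k + 1) * (2 * (1 + k)) * (2 * k + 3))"
    by (simp add: weight_ratio_def add_ac)
  also have "\<dots> = 8 * (1 + k) * (2 + k) / ((2 * k + 1) * (2 * k + 3))"
    by (rule cancel) (use nz in auto)
  finally have "weight_ratio 0 k = 8 * (1 + k) * (2 + k) / ((2 * k + 1) * (2 * k + 3))" .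
  then show ?thesis
    using weight_Suc[of 0 k] by (simp add: weight_0)
qed

lemma R_0:
  assumes "admissible k"
  shows "R 0 k = 2 * (1 + k) / ((2 * k + 3) * (2 * k + 1)\<^sup>2)"
proof -
  have nz: "2 * k + 1 \<noteq> 0" "1 + k \<noteq> 0" "2 * k + 3 \<noteq> 0"
    using linear_nonzero[OF assms] admissible_nonzero[OF assms, of 3] by auto
  have cancel: "8 * a\<^sup>2 / (2 * q * p * p * (2 * a)) = 2 * a / (q * p\<^sup>2)"
    if "a \<noteq> 0" for a p q :: complex
    using that by (simp add: power2_eq_square)
  have "R 0 k = 8 * (1 + k)\<^sup>2 / (2 * (2 * k + 3) * (2 * k + 1) * (2 * k + 1) * (2 * (1 + k)))"
    by (simp add: R_def R_num_def R_den_def add_ac)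
  also have "\<dots> = 2 * (1 + k) / ((2 * k + 3) * (2 * k + 1)\<^sup>2)"
    by (rule cancel) (use nz in auto)
  finally show ?thesis .
qed

lemma G_eq_weight_R: "G n k = weight n k * R n k"
  by (simp add: G_def weight_def)

lemma norm_linear_ge:
  assumes "Re k > 0"
  shows "norm (1 + k) \<le> norm (2 * k + 1)" "norm (2 + k) \<le> norm (2 * k + 3)" "norm (1 + k) \<le> norm (2 * k + 3)"
    "1 \<le> norm (2 * k + 1)"
proof -
  show "norm (1 + k) \<le> norm (2 * k + 1)" "norm (2 + k) \<le> norm (2 * k + 3)" "norm (1 + k) \<le> norm (2 * k + 3)"
    using assms by (auto intro!: norm_le_of_components)
  show "1 \<le> norm (2 * k + 1)" using complex_Re_le_cmod[of "2 * k + 1"] assms by simp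
qed

lemma norm_weight_0_le:
  assumes "0 < Re k" "Re k < 2"
  shows "norm (weight 0 k) \<le> 4 * pi * exp \<bar>Im k\<bar>"
proof -
  have "(norm (gamma_quot k))\<^sup>2 \<le> 4 * (1 + \<bar>Im k\<bar> + \<bar>Im k\<bar>\<^sup>2 / 2)"
    using norm_gamma_quot_bound[of k] assms by simp
  also have "\<dots> \<le> 4 * exp \<bar>Im k\<bar>"
    using exp_lower_Taylor_quadratic[of "\<bar>Im k\<bar>"] by simp
  finally show ?thesis by (simp add: weight_0 norm_mult norm_power mult_left_mono)
qed

lemma norm_weight_1_le:
  assumes "0 < Re k"
  shows "norm (weight 1 k) \<le> 8 * norm (weight 0 k)"
proof -
  have adm: "admissible k" using assms by (intro Re_gt_imp_admissible) simp
  have "norm (8 * (1 + k) * (2 + k) / ((2 * k + 1) * (2 * k + 3)))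
     = 8 * (norm (1 + k) / norm (2 * k + 1) * (norm (2 + k) / norm (2 * k + 3)))"
    unfolding norm_mult norm_divide norm_numeral by simp
  also have "\<dots> \<le> 8 * (1 * 1)"
    using norm_linear_ge[OF assms] by (intro mult_left_mono mult_mono) (auto simp: divide_le_eq_1)
  finally have "norm (8 * (1 + k) * (2 + k) / ((2 * k + 1) * (2 * k + 3))) \<le> 8" by simp
  then show ?thesis
    unfolding weight_1[OF adm] weight_0[symmetric] norm_mult[of _ "weight 0 k"] by (intro mult_right_mono) auto
qed

text \<open>
  Of the exponent \<open>3 \<bar>Im k\<bar>\<close>, one part \<open>\<bar>Im k\<bar>\<close> bounds the polynomial growth of \<open>gamma_quot\<^sup>2\<close> and
  \<open>2 \<bar>Im k\<bar>\<close> comes from the initial terms that do not yet decay.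
\<close>

lemma norm_G_le_strip:
  assumes "0 < Re k" "Re k < 2"
  shows "norm (G n k) \<le> (32 * pi) * exp (3 * \<bar>Im k\<bar>) * majorant n"
proof -
  have e: "exp (3 * \<bar>Im k\<bar>) = exp \<bar>Im k\<bar> * exp (2 * \<bar>Im k\<bar>)" by (simp flip: exp_add)
  show ?thesis
  proof (cases "n = 0")
    case True
    have adm: "admissible k" using assms by (intro Re_gt_imp_admissible) simp
    have "norm (R 0 k) = 2 * (norm (1 + k) / norm (2 * k + 3) * (1 / (norm (2 * k + 1))\<^sup>2))"
      unfolding R_0[OF adm] norm_mult norm_divide norm_power norm_numeral by simp
    also have "\<dots> \<le> 2 * (1 * 1)"
      using norm_linear_ge[OF assms(1)] by (intro mult_left_mono mult_mono) (auto simp: divide_le_eq_1)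
    finally have "norm (R 0 k) \<le> 2" by simp
    then have "norm (G 0 k) \<le> (4 * pi * exp \<bar>Im k\<bar>) * 2"
      unfolding G_eq_weight_R norm_mult using norm_weight_0_le[OF assms] by (intro mult_mono) auto
    also have "\<dots> = (32 * pi) * exp \<bar>Im k\<bar> * (1 / 4)" by simp
    also have "\<dots> \<le> (32 * pi) * exp (3 * \<bar>Im k\<bar>) * majorant 0"
      by (intro mult_mono) (auto simp: majorant_def)
    finally show ?thesis using True by simp
  next
    case False
    then have "norm (G n k) \<le> norm (weight 1 k) * exp (2 * \<bar>Im k\<bar>) * majorant n"
      using assms by (intro norm_G_le) auto
    also have "\<dots> \<le> (32 * pi * exp \<bar>Im k\<bar>) * exp (2 * \<bar>Im k\<bar>) * majorant n"
      using norm_weight_1_le[OF assms(1)] norm_weight_0_le[OF assms] majorant_ge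
      by (intro mult_right_mono) auto
    also have "\<dots> = (32 * pi) * exp (3 * \<bar>Im k\<bar>) * majorant n"
      unfolding e by (simp only: mult_ac)
    finally show ?thesis .
  qed
qed

lemma summable_G_strip:
  assumes "0 < Re k" "Re k < 2"
  shows "summable (\<lambda>n. G n k)"
  by (rule summable_comparison_test'[of "\<lambda>n. (32 * pi) * exp (3 * \<bar>Im k\<bar>) * majorant n" 0])
     (use norm_G_le_strip[OF assms] in \<open>auto intro!: summable_mult summable_majorant\<close>)

lemma norm_suminf_G_strip_le:
  assumes "0 < Re k" "Re k < 2"
  shows "norm (\<Sum>n. G n k) \<le> (32 * pi * suminf majorant) * exp (3 * \<bar>Im k\<bar>)"
proof -
  have "norm (\<Sum>n. G n k) \<le> (\<Sum>n. (32 * pi) * exp (3 * \<bar>Im k\<bar>) * majorant n)"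
    using norm_G_le_strip[OF assms] by (intro norm_suminf_le summable_mult summable_majorant) auto
  also have "\<dots> = (32 * pi) * exp (3 * \<bar>Im k\<bar>) * suminf majorant"
    by (rule suminf_mult[OF summable_majorant])
  finally show ?thesis by (simp only: mult_ac)
qed

section \<open>The sum is constant\<close>

lemma weight_holomorphic: "weight n holomorphic_on {k. Re k > - (1 / 2)}"
proof (induction n)
  case 0
  have "1 + k \<notin> \<int>\<^sub>\<le>\<^sub>0" if "Re k > - (1 / 2)" for k
    using admissible_notin_nonpos_Ints(1) Re_gt_imp_admissible[OF that] by blast
  then have "(\<lambda>k. of_real pi * (gamma_quot k)\<^sup>2) holomorphic_on {k. Re k > - (1 / 2)}"
    unfolding gamma_quot_def by (intro holomorphic_intros) auto
  then show ?case by (simp add: weight_0[abs_def])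
next
  case (Suc n)
  have "weight_ratio n holomorphic_on {k. Re k > - (1 / 2)}"
    unfolding weight_ratio_def[abs_def]
    by (intro holomorphic_intros) (use linear_nonzero[OF Re_gt_imp_admissible] in auto)
  then have "(\<lambda>k. weight_ratio n k * weight n k) holomorphic_on {k. Re k > - (1 / 2)}"
    by (intro holomorphic_on_mult Suc.IH)
  then show ?case by (simp add: weight_Suc[abs_def])
qed

lemma G_holomorphic: "G n holomorphic_on {k. Re k > - (1 / 2)}"
proof -
  have "R_den n k \<noteq> 0" if "Re k > - (1 / 2)" for k
    using admissible_iff_G_defined[of k] Re_gt_imp_admissible[OF that] by (auto simp: G_defined_def)
  then have "R n holomorphic_on {k. Re k > - (1 / 2)}"
    unfolding R_def[abs_def] by (intro holomorphic_intros) (auto simp: R_num_def R_den_def intro!: holomorphic_intros)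
  then have "(\<lambda>k. weight n k * R n k) holomorphic_on {k. Re k > - (1 / 2)}"
    by (intro holomorphic_on_mult weight_holomorphic)
  then show ?thesis by (simp add: G_eq_weight_R[abs_def])
qed

lemma suminf_G_holomorphic: "(\<lambda>k. \<Sum>n. G n k) holomorphic_on {k. 0 < Re k \<and> Re k < 2}"
proof (rule holomorphic_uniform_sequence)
  let ?S = "{k. 0 < Re k \<and> Re k < 2}"
  have S: "?S = {k. 0 < Re k} \<inter> {k. Re k < 2}" by auto
  show op: "open ?S" unfolding S by (intro open_Int open_halfspace_Re_gt open_halfspace_Re_lt)
  show "(\<lambda>k. \<Sum>n<N. G n k) holomorphic_on ?S" for N
    by (intro holomorphic_on_sum holomorphic_on_subset[OF G_holomorphic]) auto
  fix z assume z: "z \<in> ?S"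
  then obtain d where d: "d > 0" "cball z d \<subseteq> ?S" using op open_contains_cball by blast
  have "uniform_limit (cball z d) (\<lambda>N k. \<Sum>n<N. G n k) (\<lambda>k. \<Sum>n. G n k) sequentially"
  proof (rule Weierstrass_m_test)
    fix n k assume k: "k \<in> cball z d"
    have "\<bar>Im k - Im z\<bar> \<le> norm (k - z)" using abs_Im_le_cmod[of "k - z"] by simp
    then have "\<bar>Im k\<bar> \<le> \<bar>Im z\<bar> + d" using k by (simp add: dist_norm norm_minus_commute)
    then have "exp (3 * \<bar>Im k\<bar>) \<le> exp (3 * (\<bar>Im z\<bar> + d))" by simp
    then have "(32 * pi) * exp (3 * \<bar>Im k\<bar>) * majorant n \<le> (32 * pi) * exp (3 * (\<bar>Im z\<bar> + d)) * majorant n"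
      by (intro mult_right_mono mult_left_mono majorant_ge) auto
    moreover have "norm (G n k) \<le> (32 * pi) * exp (3 * \<bar>Im k\<bar>) * majorant n"
      using d(2) k by (intro norm_G_le_strip) auto
    ultimately show "norm (G n k) \<le> (32 * pi) * exp (3 * (\<bar>Im z\<bar> + d)) * majorant n"
      by linarith
  next
    show "summable (\<lambda>n. (32 * pi) * exp (3 * (\<bar>Im z\<bar> + d)) * majorant n)"
      by (intro summable_mult summable_majorant)
  qed
  then show "\<exists>d>0. cball z d \<subseteq> ?S \<and> uniform_limit (cball z d) (\<lambda>N k. \<Sum>n<N. G n k) (\<lambda>k. \<Sum>n. G n k) sequentially"
    using d by blast
qed

lemma suminf_G_strip_constant:
  assumes "0 < Re k" "Re k < 2"
  shows "(\<Sum>n. G n k) = (\<Sum>n. G n 1)"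
proof (rule periodic_small_growth_imp_constant[of "\<lambda>k. \<Sum>n. G n k" "32 * pi * suminf majorant" 3])
  fix z :: complex assume z: "0 < Re z" "Re z < 1"
  then have "(\<lambda>n. G n z) sums (\<Sum>n. G n z)" by (intro summable_sums summable_G_strip) auto
  then have "(\<lambda>n. G n (z + 1)) sums (\<Sum>n. G n z)"
    using z by (subst G_sums_plus_1_iff) (auto intro: Re_gt_imp_admissible)
  then show "(\<Sum>n. G n (z + 1)) = (\<Sum>n. G n z)" by (simp add: sums_iff)
next
  show "(3 :: real) < 2 * pi" using pi_gt3 by simp
qed (use assms suminf_G_holomorphic norm_suminf_G_strip_le in auto)

section \<open>The value of the sum\<close>

text \<open>
  Along a sequence \<open>\<kappa>\<close> that decreases to \<open>-1/2\<close>, the tail from \<open>n = 1\<close> on is at most a constant times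
  \<open>\<bar>weight 1 (\<kappa> m)\<bar>\<close>. This tends to 0, since the simple pole of \<open>weight_ratio 0\<close> meets the double
  zero of \<open>gamma_quot\<^sup>2\<close>. In the term \<open>n = 0\<close> the double pole of \<open>R 0\<close> cancels that zero, which
  leaves \<open>\<pi>\<^sup>2/8\<close>.
\<close>

lemma suminf_G_1: "(\<Sum>n. G n 1) = of_real (pi\<^sup>2 / 8)"
proof -
  let ?c = "\<Sum>n. G n 1"
  define \<kappa> where "\<kappa> m = complex_of_real (inverse (real (Suc m)) / 2 - 1 / 2)" for m
  have \<kappa>: "- (1 / 2) < Re (\<kappa> m)" "Re (\<kappa> m) \<le> 0" "Im (\<kappa> m) = 0" for m
    by (simp_all add: \<kappa>_def field_simps)
  have \<kappa>_lim: "\<kappa> \<longlonglongrightarrow> - (1 / 2)"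
  proof -
    have "\<kappa> \<longlonglongrightarrow> of_real (0 / 2 - 1 / 2)"
      unfolding \<kappa>_def by (intro tendsto_of_real tendsto_diff tendsto_divide tendsto_const LIMSEQ_inverse_real_of_nat) simp
    then show ?thesis by simp
  qed
  have adm: "admissible (\<kappa> m)" for m using \<kappa> by (intro Re_gt_imp_admissible)
  have sums: "(\<lambda>n. G n (\<kappa> m)) sums ?c" for m
  proof -
    have strip: "0 < Re (\<kappa> m + 1)" "Re (\<kappa> m + 1) < 2" using \<kappa>[of m] by auto
    have "(\<lambda>n. G n (\<kappa> m + 1)) sums ?c"
      using summable_sums[OF summable_G_strip[OF strip]] suminf_G_strip_constant[OF strip] by simp
    then show ?thesis using G_sums_plus_1_iff[OF adm] by blast
  qed
  have tail: "norm (?c - G 0 (\<kappa> m)) \<le> norm (weight 1 (\<kappa> m)) * (\<Sum>n. majorant (Suc n))" for m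
  proof -
    have le: "norm (G (Suc n) (\<kappa> m)) \<le> norm (weight 1 (\<kappa> m)) * majorant (Suc n)" for n
      using norm_G_le[of "Suc n" "\<kappa> m"] \<kappa>[of m] by simp
    have maj: "summable (\<lambda>n. majorant (Suc n))" by (subst summable_Suc_iff) (rule summable_majorant)
    have "?c - G 0 (\<kappa> m) = (\<Sum>n. G (Suc n) (\<kappa> m))"
      using suminf_split_head[OF sums_summable[OF sums[of m]]] sums_unique[OF sums[of m]] by simp
    also have "norm \<dots> \<le> (\<Sum>n. norm (weight 1 (\<kappa> m)) * majorant (Suc n))"
      using le by (intro norm_suminf_le summable_mult maj) auto
    finally show ?thesis by (simp add: suminf_mult maj)
  qed
  have shifted_lim: "(\<lambda>m. (gamma_quot_shifted (\<kappa> m))\<^sup>2) \<longlonglongrightarrow> of_real pi"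
  proof -
    have np: "1 / 2 \<notin> (\<int>\<^sub>\<le>\<^sub>0 :: complex set)"
      using admissible_notin_nonpos_Ints(2)[of 0] by (simp add: admissible_def)
    have "(\<lambda>m. (gamma_quot_shifted (\<kappa> m))\<^sup>2)
      \<longlonglongrightarrow> (Gamma (1 + - (1 / 2)) * rGamma (3 / 2 + - (1 / 2)))\<^sup>2"
      unfolding gamma_quot_shifted_def using np
      by (intro tendsto_intros \<kappa>_lim
          isCont_tendsto_compose[OF field_differentiable_imp_continuous_at[OF field_differentiable_rGamma]]) simp
    also have "(Gamma (1 + - (1 / 2)) * rGamma (3 / 2 + - (1 / 2)))\<^sup>2 = (of_real pi :: complex)"
      by (simp add: Gamma_one_half_complex flip: of_real_power)
    finally show ?thesis .
  qed
  have weight_lim: "(\<lambda>m. weight 1 (\<kappa> m)) \<longlonglongrightarrow> 0"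
  proof -
    have cancel: "8 * a * b / (p * q) * (c * (p / 2 * s)\<^sup>2) = 2 * a * b * p / q * (c * s\<^sup>2)"
      if "p \<noteq> 0" for a b c p q s :: complex
      using that by (simp add: power2_eq_square)
    have "weight 1 (\<kappa> m) = 2 * (1 + \<kappa> m) * (2 + \<kappa> m) * (2 * \<kappa> m + 1) / (2 * \<kappa> m + 3)
        * (of_real pi * (gamma_quot_shifted (\<kappa> m))\<^sup>2)" for m
      unfolding weight_1[OF adm] gamma_quot_eq_shifted by (rule cancel) (rule linear_nonzero(1)[OF adm])
    moreover have "(\<lambda>m. 2 * (1 + \<kappa> m) * (2 + \<kappa> m) * (2 * \<kappa> m + 1) / (2 * \<kappa> m + 3)
        * (of_real pi * (gamma_quot_shifted (\<kappa> m))\<^sup>2))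
      \<longlonglongrightarrow> 2 * (1 + - (1 / 2)) * (2 + - (1 / 2)) * (2 * - (1 / 2) + 1) / (2 * - (1 / 2) + 3)
        * (of_real pi * of_real pi)"
      by (intro tendsto_intros \<kappa>_lim shifted_lim) simp
    ultimately show ?thesis by simp
  qed
  have "(\<lambda>m. norm (weight 1 (\<kappa> m)) * (\<Sum>n. majorant (Suc n))) \<longlonglongrightarrow> 0"
    using tendsto_mult_left_zero[OF tendsto_norm_zero[OF weight_lim]] .
  then have "(\<lambda>m. ?c - G 0 (\<kappa> m)) \<longlonglongrightarrow> 0"
    using tail by (intro Lim_null_comparison[of "\<lambda>m. ?c - G 0 (\<kappa> m)"]) (auto intro: always_eventually)
  then have "(\<lambda>m. ?c - (?c - G 0 (\<kappa> m))) \<longlonglongrightarrow> ?c - 0"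
    by (intro tendsto_intros)
  then have "(\<lambda>m. G 0 (\<kappa> m)) \<longlonglongrightarrow> ?c" by simp
  moreover have "(\<lambda>m. G 0 (\<kappa> m)) \<longlonglongrightarrow> of_real (pi\<^sup>2 / 8)"
  proof -
    have cancel: "c * (p / 2 * s)\<^sup>2 * (2 * a / (q * p\<^sup>2)) = c * s\<^sup>2 * a / (2 * q)"
      if "p \<noteq> 0" for a c p q s :: complex
      using that by (simp add: power2_eq_square)
    have "G 0 (\<kappa> m) = of_real pi * (gamma_quot_shifted (\<kappa> m))\<^sup>2 * (1 + \<kappa> m) / (2 * (2 * \<kappa> m + 3))" for m
      unfolding G_eq_weight_R weight_0 R_0[OF adm] gamma_quot_eq_shifted
      by (rule cancel) (rule linear_nonzero(1)[OF adm])
    moreover have "(\<lambda>m. of_real pi * (gamma_quot_shifted (\<kappa> m))\<^sup>2 * (1 + \<kappa> m) / (2 * (2 * \<kappa> m + 3)))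
      \<longlonglongrightarrow> of_real pi * of_real pi * (1 + - (1 / 2)) / (2 * (2 * - (1 / 2) + 3))"
      by (intro tendsto_intros \<kappa>_lim shifted_lim) simp
    ultimately show ?thesis by (simp add: power2_eq_square)
  qed
  ultimately show ?thesis by (rule LIMSEQ_unique)
qed

lemma G_sums:
  assumes "admissible k"
  shows "(\<lambda>n. G n k) sums of_real (pi\<^sup>2 / 8)"
proof -
  have strip: "(\<lambda>n. G n z) sums of_real (pi\<^sup>2 / 8)" if "0 < Re z" "Re z < 2" for z
    using summable_sums[OF summable_G_strip[OF that]] suminf_G_strip_constant[OF that] suminf_G_1 by simp
  show ?thesis
  proof (cases "Re k \<ge> 1")
    case True
    define j where "j = nat (\<lfloor>Re k\<rfloor> - 1)"
    have j: "real j = of_int \<lfloor>Re k\<rfloor> - 1" using True by (simp add: j_def le_floor_iff of_nat_nat)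
    have re: "0 < Re (k - of_nat j)" "Re (k - of_nat j) < 2" using j by (simp_all, linarith+)
    then have "admissible (k - of_nat j)" by (intro Re_gt_imp_admissible) linarith
    from G_sums_plus_nat_iff[OF this, of j] show ?thesis using strip[OF re] by simp
  next
    case False
    define j where "j = nat (1 - \<lfloor>Re k\<rfloor>)"
    have j: "real j = 1 - of_int \<lfloor>Re k\<rfloor>" using False by (simp add: j_def of_nat_nat floor_le_iff)
    have re: "0 < Re (k + of_nat j)" "Re (k + of_nat j) < 2" using j by (simp_all, linarith+)
    show ?thesis using G_sums_plus_nat_iff[OF assms, of j] strip[OF re] by simp
  qed
qed

theorem mainTheorem4:
  shows "(\<forall>k::complex. (\<forall>n. G_defined n k) \<longleftrightarrow> \<not> (\<exists>m::int. m < 0 \<and> 2 * k = of_int m))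
    \<and> (\<forall>k::complex. \<not> (\<exists>m::int. m < 0 \<and> 2 * k = of_int m) \<longrightarrow>
          (\<lambda>n. G n k) sums (of_real (pi\<^sup>2 / 8)))
    \<and> (\<forall>k::complex. (\<exists>m::int. m < 0 \<and> 2 * k = of_int m) \<longrightarrow>
          removable_singularity_at (\<lambda>z. \<Sum>n. G n z) k)"
  unfolding admissible_def[symmetric]
proof (intro conjI allI impI)
  fix k :: complex
  show "(\<forall>n. G_defined n k) \<longleftrightarrow> admissible k" by (rule admissible_iff_G_defined)
next
  fix k :: complex
  assume "admissible k"
  then show "(\<lambda>n. G n k) sums of_real (pi\<^sup>2 / 8)" by (rule G_sums)
next
  fix k :: complex
  assume "\<exists>m::int. m < 0 \<and> 2 * k = of_int m"
  then obtain m :: int where m: "2 * k = of_int m" by blast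
  \<comment> \<open>The exceptional parameters are half-integers, hence at distance at least \<open>1/2\<close> from each other.\<close>
  have adm: "admissible z" if z: "z \<in> ball k (1 / 2) - {k}" for z
    unfolding admissible_def
  proof (intro notI, elim exE conjE)
    fix j :: int assume j: "2 * z = of_int j"
    then have "2 * (k - z) = of_int (m - j)" using m by simp
    then have "norm (of_int (m - j) :: complex) = 2 * norm (k - z)" by (metis norm_mult norm_numeral)
    also have "\<dots> < 1" using z by (simp add: dist_norm)
    finally have "m - j = 0" unfolding norm_of_int by linarith
    then have "2 * k = 2 * z" using m j by simp
    then show False using z by simp
  qed
  have const: "(\<Sum>n. G n z) = of_real (pi\<^sup>2 / 8)" if "z \<in> ball k (1 / 2) - {k}" for z
    using G_sums[OF adm[OF that]] by (rule sums_unique[symmetric])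
  have "(\<lambda>z. \<Sum>n. G n z) holomorphic_on ball k (1 / 2) - {k}"
    by (subst holomorphic_cong[OF refl const]) auto
  then have "(\<lambda>z. \<Sum>n. G n z) analytic_on ball k (1 / 2) - {k}"
    by (subst analytic_on_open) (auto intro: open_delete)
  then have "isolated_singularity_at (\<lambda>z. \<Sum>n. G n z) k"
    unfolding isolated_singularity_at_def by (intro exI[of _ "1 / 2"]) auto
  moreover have "((\<lambda>z. \<Sum>n. G n z) \<longlongrightarrow> of_real (pi\<^sup>2 / 8)) (at k)"
  proof (rule tendsto_eventually)
    show "\<forall>\<^sub>F z in at k. (\<Sum>n. G n z) = of_real (pi\<^sup>2 / 8)"
      unfolding eventually_at using const by (intro exI[of _ "1 / 2"]) (auto simp: dist_commute)
  qed
  ultimately show "removable_singularity_at (\<lambda>z. \<Sum>n. G n z) k"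
    unfolding removable_singularity_at_def by blast
qed

end
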